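(* Let $k$ be a field, $R$ a commutative ring, and $\mu:K_0\mathrm{Var}(k)\to R$ a motivic measure which can be exponentiated. Let $X$ and $Y$ be varieties over $k$. If $\zeta_\mu(X;t)$ and $\zeta_\mu(Y;t)$ are rational functions (elements of $W_{\mathrm{rat}}(R)$), then $\zeta_\mu(X\times Y;t)$ is also a rational function.
   Context: Varieties: a variety over a field $k$ is a reduced separated $k$-scheme of finite type. The Grothendieck ring of varieties $K_0\mathrm{Var}(k)$ is the quotient of the free abelian group on isomorphism classes $[X]$ of varieties by the relations $[X]=[Y]+[X\setminus Y]$ for $Y\subset X$ a closed subvariety (and, when $k$ has positive characteristic, also $[X]=[Y]$ for every surjective radicial morphism $X\to Y$). Multiplication is induced by the product over $\mathrm{Spec}(k)$. A motivic measure is a ring homomorphism $\mu:K_0\mathrm{Var}(k)\to R$ to a commutative ring $R$. Big Witt ring: for a commutative ring $R$, the additive group of $W(R)$ is the group of power series in $R[[t]]$ with constant term $1$ under multiplication of power series; its addition is written $+_W$, its subtraction $-_W$, and its zero is the series $1$. The multiplication $\ast$ is the standard big Witt ring multiplication, characterized by $(1-at)^{-1}\ast(1-bt)^{-1}=(1-abt)^{-1}$ for all $a,b\in R$ and by functoriality of $R\mapsto W(R)$ as an endofunctor of commutative rings (ring homomorphisms act on coefficients). The unit is $(1-t)^{-1}$. An element of $W(R)$ is called a rational function if it has the form $p(t)-_Wq(t)$ with $p(t),q(t)\in R[t]$ and $p(0)=q(0)=1$; $W_{\mathrm{rat}}(R)\subset W(R)$ denotes the subset of these. Kapranov's zeta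 function: for a quasi-projective variety $X$, $\zeta_\mu(X;t):=\sum_{n\ge 0}\mu([S^n(X)])t^n$, where $S^n(X)$ is the $n$-th symmetric product. The assignment $X\mapsto\zeta_\mu(X;t)$ extends uniquely to a group homomorphism $\zeta_\mu(-;t):K_0\mathrm{Var}(k)\to W(R)$ ($K_0\mathrm{Var}(k)$ is generated by quasi-projective varieties), and $\zeta_\mu(X;t)$ denotes its value on $[X]$ for any variety $X$. The motivic measure $\mu$ can be exponentiated if this group homomorphism is a ring homomorphism. *)

theory Defs
  imports "HOL-Analysis.Abstract_Topology" "HOL-Combinatorics.Permutations"
    "HOL-Computational_Algebra.Primes"
    "HOL-Algebra.Free_Abelian_Groups" "HOL-Algebra.Generated_Rings" "HOL-Algebra.QuotRing"
    "HOL-Algebra.UnivPoly"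
begin

section \<open>Locally ringed spaces\<close>

text \<open>
  The space is a topology in the sense of \<^const>\<open>topspace\<close> and \<^const>\<open>openin\<close>; \<open>sec X U\<close> is the
  ring of sections over \<open>U\<close>, and \<open>res X U V\<close> restricts sections from \<open>U\<close> to \<open>V\<close>.  The values of
  \<open>sec\<close> and \<open>res\<close> at sets that are not open are irrelevant, and so are the values of a map of
  spaces, or of sections, outside its domain; this is why morphisms are compared by \<open>eq_mor\<close>
  rather than by equality.
\<close>

record ('p, 's) ringed_space =
  space :: "'p topology"
  sec :: "'p set \<Rightarrow> 's ring"
  res :: "'p set \<Rightarrow> 'p set \<Rightarrow> 's \<Rightarrow> 's"

abbreviation pts :: "('p, 's, 'z) ringed_space_scheme \<Rightarrow> 'p set"
  where "pts X \<equiv> topspace (space X)"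

definition ringed :: "('p, 's, 'z) ringed_space_scheme \<Rightarrow> bool"
  where "ringed X \<longleftrightarrow>
    (\<forall>U. openin (space X) U \<longrightarrow> cring (sec X U)) \<and>
    (\<forall>U V. openin (space X) U \<and> openin (space X) V \<and> V \<subseteq> U \<longrightarrow>
       res X U V \<in> ring_hom (sec X U) (sec X V)) \<and>
    (\<forall>U s. openin (space X) U \<and> s \<in> carrier (sec X U) \<longrightarrow> res X U U s = s) \<and>
    (\<forall>U V W s. openin (space X) U \<and> openin (space X) V \<and> openin (space X) W \<and>
       V \<subseteq> U \<and> W \<subseteq> V \<and> s \<in> carrier (sec X U) \<longrightarrow>
       res X V W (res X U V s) = res X U W s) \<and>
    (\<forall>\<U> s. (\<forall>U\<in>\<U>. openin (space X) U \<and> s U \<in> carrier (sec X U)) \<and>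
       (\<forall>U\<in>\<U>. \<forall>V\<in>\<U>. res X U (U \<inter> V) (s U) = res X V (U \<inter> V) (s V)) \<longrightarrow>
       (\<exists>!t. t \<in> carrier (sec X (\<Union>\<U>)) \<and> (\<forall>U\<in>\<U>. res X (\<Union>\<U>) U t = s U)))"

definition germ ::
  "('p, 's, 'z) ringed_space_scheme \<Rightarrow> 'p \<Rightarrow> 'p set \<Rightarrow> 's \<Rightarrow> ('p set \<times> 's) set"
  where "germ X x U s =
    {(V, t). openin (space X) V \<and> x \<in> V \<and> t \<in> carrier (sec X V) \<and>
       (\<exists>W. openin (space X) W \<and> x \<in> W \<and> W \<subseteq> U \<inter> V \<and> res X U W s = res X V W t)}"

text \<open>
  A germ is an equivalence class of pairs.  Here and below, an operation on classes is given, as in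
  \<^const>\<open>rcoset_mult\<close>, by the union of the results over all representatives, all of which agree.
\<close>

definition stalk :: "('p, 's, 'z) ringed_space_scheme \<Rightarrow> 'p \<Rightarrow> ('p set \<times> 's) set ring"
  where "stalk X x =
    \<lparr>carrier = {germ X x U s | U s. openin (space X) U \<and> x \<in> U \<and> s \<in> carrier (sec X U)},
     mult = (\<lambda>A B. \<Union>(U, s)\<in>A. \<Union>(V, t)\<in>B. germ X x (U \<inter> V)
       (res X U (U \<inter> V) s \<otimes>\<^bsub>sec X (U \<inter> V)\<^esub> res X V (U \<inter> V) t)),
     one = germ X x (pts X) \<one>\<^bsub>sec X (pts X)\<^esub>,
     zero = germ X x (pts X) \<zero>\<^bsub>sec X (pts X)\<^esub>,
     add = (\<lambda>A B. \<Union>(U, s)\<in>A. \<Union>(V, t)\<in>B. germ X x (U \<inter> V)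
       (res X U (U \<inter> V) s \<oplus>\<^bsub>sec X (U \<inter> V)\<^esub> res X V (U \<inter> V) t))\<rparr>"

definition local_ring :: "('a, 'm) ring_scheme \<Rightarrow> bool"
  where "local_ring A \<longleftrightarrow> cring A \<and> (\<exists>!I. maximalideal I A)"

definition locally_ringed :: "('p, 's, 'z) ringed_space_scheme \<Rightarrow> bool"
  where "locally_ringed X \<longleftrightarrow> ringed X \<and> (\<forall>x\<in>pts X. local_ring (stalk X x))"

text \<open>
  A morphism from \<open>X\<close> to \<open>Y\<close> consists of a map of points and, for each open subset \<open>V\<close> of \<open>Y\<close>, a
  map from sections of \<open>Y\<close> over \<open>V\<close> to sections of \<open>X\<close> over the preimage of \<open>V\<close>.
\<close>

record ('p, 's, 'q, 't) mor =
  pt :: "'p \<Rightarrow> 'q"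
  pull :: "'q set \<Rightarrow> 't \<Rightarrow> 's"

definition preim ::
  "('p, 's, 'z) ringed_space_scheme \<Rightarrow> ('p, 's, 'q, 't) mor \<Rightarrow> 'q set \<Rightarrow> 'p set"
  where "preim X f V = {x \<in> pts X. pt f x \<in> V}"

definition stalk_map ::
  "('p, 's, 'z) ringed_space_scheme \<Rightarrow> ('p, 's, 'q, 't) mor \<Rightarrow> 'p \<Rightarrow> ('q set \<times> 't) set \<Rightarrow>
    ('p set \<times> 's) set"
  where "stalk_map X f x A = (\<Union>(V, t)\<in>A. germ X x (preim X f V) (pull f V t))"

definition morphism ::
  "('p, 's, 'z) ringed_space_scheme \<Rightarrow> ('q, 't, 'y) ringed_space_scheme \<Rightarrow>
    ('p, 's, 'q, 't) mor \<Rightarrow> bool"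
  where "morphism X Y f \<longleftrightarrow>
    continuous_map (space X) (space Y) (pt f) \<and>
    (\<forall>V. openin (space Y) V \<longrightarrow> pull f V \<in> ring_hom (sec Y V) (sec X (preim X f V))) \<and>
    (\<forall>V W t. openin (space Y) V \<and> openin (space Y) W \<and> W \<subseteq> V \<and> t \<in> carrier (sec Y V) \<longrightarrow>
       pull f W (res Y V W t) = res X (preim X f V) (preim X f W) (pull f V t)) \<and>
    (\<forall>x\<in>pts X. \<forall>A\<in>carrier (stalk Y (pt f x)).
       stalk_map X f x A \<in> Units (stalk X x) \<longrightarrow> A \<in> Units (stalk Y (pt f x)))"

definition eq_mor ::
  "('p, 's, 'z) ringed_space_scheme \<Rightarrow> ('q, 't, 'y) ringed_space_scheme \<Rightarrow>
    ('p, 's, 'q, 't) mor \<Rightarrow> ('p, 's, 'q, 't) mor \<Rightarrow> bool"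
  where "eq_mor X Y f g \<longleftrightarrow>
    (\<forall>x\<in>pts X. pt f x = pt g x) \<and>
    (\<forall>V. openin (space Y) V \<longrightarrow> (\<forall>t\<in>carrier (sec Y V). pull f V t = pull g V t))"

definition id_mor :: "('p, 's, 'p, 's) mor"
  where "id_mor = \<lparr>pt = (\<lambda>x. x), pull = (\<lambda>V t. t)\<rparr>"

text \<open>\<open>comp_mor Y g f\<close> is \<open>g\<close> after \<open>f\<close>, where \<open>Y\<close> is the codomain of \<open>f\<close> and the domain of \<open>g\<close>.\<close>

definition comp_mor ::
  "('q, 't, 'y) ringed_space_scheme \<Rightarrow> ('q, 't, 'r, 'u) mor \<Rightarrow> ('p, 's, 'q, 't) mor \<Rightarrow>
    ('p, 's, 'r, 'u) mor"
  where "comp_mor Y g f =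
    \<lparr>pt = (\<lambda>x. pt g (pt f x)), pull = (\<lambda>W u. pull f (preim Y g W) (pull g W u))\<rparr>"

definition isomorphism ::
  "('p, 's, 'z) ringed_space_scheme \<Rightarrow> ('q, 't, 'y) ringed_space_scheme \<Rightarrow>
    ('p, 's, 'q, 't) mor \<Rightarrow> bool"
  where "isomorphism X Y f \<longleftrightarrow> morphism X Y f \<and>
    (\<exists>g. morphism Y X g \<and> eq_mor X X (comp_mor Y g f) id_mor \<and>
       eq_mor Y Y (comp_mor X f g) id_mor)"

definition open_sub :: "('p, 's, 'z) ringed_space_scheme \<Rightarrow> 'p set \<Rightarrow> ('p, 's) ringed_space"
  where "open_sub X U = \<lparr>space = subtopology (space X) U, sec = sec X, res = res X\<rparr>"

definition open_incl :: "('p, 's, 'z) ringed_space_scheme \<Rightarrow> 'p set \<Rightarrow> ('p, 's, 'p, 's) mor"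
  where "open_incl X U = \<lparr>pt = (\<lambda>x. x), pull = (\<lambda>V. res X V (V \<inter> U))\<rparr>"

text \<open>The last condition says that the map from the structure sheaf of \<open>X\<close> to the direct image of
  that of \<open>Y\<close> is a surjection of sheaves.\<close>

definition closed_immersion ::
  "('p, 's, 'z) ringed_space_scheme \<Rightarrow> ('q, 't, 'y) ringed_space_scheme \<Rightarrow>
    ('p, 's, 'q, 't) mor \<Rightarrow> bool"
  where "closed_immersion Y X i \<longleftrightarrow> morphism Y X i \<and>
    embedding_map (space Y) (space X) (pt i) \<and> closedin (space X) (pt i ` pts Y) \<and>
    (\<forall>V. openin (space X) V \<longrightarrow> (\<forall>s\<in>carrier (sec Y (preim Y i V)). \<forall>x\<in>V.
       \<exists>W. openin (space X) W \<and> x \<in> W \<and> W \<subseteq> V \<and>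
         (\<exists>t\<in>carrier (sec X W). pull i W t = res Y (preim Y i V) (preim Y i W) s)))"


section \<open>Spectra and projective spaces\<close>

text \<open>\<open>frac A p a b\<close> is the fraction \<open>a/b\<close> in the localization of \<open>A\<close> at the prime ideal \<open>p\<close>.\<close>

definition frac :: "('a, 'm) ring_scheme \<Rightarrow> 'a set \<Rightarrow> 'a \<Rightarrow> 'a \<Rightarrow> ('a \<times> 'a) set"
  where "frac A p a b = {(c, d). c \<in> carrier A \<and> d \<in> carrier A - p \<and>
    (\<exists>u\<in>carrier A - p. u \<otimes>\<^bsub>A\<^esub> (a \<otimes>\<^bsub>A\<^esub> d) = u \<otimes>\<^bsub>A\<^esub> (c \<otimes>\<^bsub>A\<^esub> b))}"

text \<open>The complements of the sets \<open>V(a)\<close> form a basis of the Zariski topology.\<close>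

definition zariski :: "('a, 'm) ring_scheme \<Rightarrow> 'a set topology"
  where "zariski A = topology_generated_by {{p. primeideal p A \<and> a \<notin> p} | a. a \<in> carrier A}"

text \<open>
  A set \<open>P\<close> of prime ideals carries the subspace topology and the sheaf of functions that are
  locally of the form \<open>a/b\<close>, with \<open>(a, b)\<close> in a given set \<open>F\<close> of pairs.  All primes and all pairs
  give \<open>Spec A\<close>.  For a graded ring, the homogeneous primes not containing the irrelevant ideal and
  the pairs of homogeneous elements of equal degree give \<open>Proj A\<close>.
\<close>

definition frac_space ::
  "('a, 'm) ring_scheme \<Rightarrow> 'a set set \<Rightarrow> ('a \<times> 'a) set \<Rightarrow>
    ('a set, 'a set \<Rightarrow> ('a \<times> 'a) set) ringed_space"
  where "frac_space A P F =
    \<lparr>space = subtopology (zariski A) P,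
     sec = (\<lambda>U.
       \<lparr>carrier = {s \<in> extensional U. \<forall>p\<in>U. \<exists>V a b.
          openin (subtopology (zariski A) P) V \<and> p \<in> V \<and> V \<subseteq> U \<and> (a, b) \<in> F \<and>
          (\<forall>q\<in>V. b \<notin> q \<and> s q = frac A q a b)},
        mult = (\<lambda>s t. \<lambda>p\<in>U. \<Union>(a, b)\<in>s p. \<Union>(c, d)\<in>t p. frac A p (a \<otimes>\<^bsub>A\<^esub> c) (b \<otimes>\<^bsub>A\<^esub> d)),
        one = (\<lambda>p\<in>U. frac A p \<one>\<^bsub>A\<^esub> \<one>\<^bsub>A\<^esub>),
        zero = (\<lambda>p\<in>U. frac A p \<zero>\<^bsub>A\<^esub> \<one>\<^bsub>A\<^esub>),
        add = (\<lambda>s t. \<lambda>p\<in>U. \<Union>(a, b)\<in>s p. \<Union>(c, d)\<in>t p.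
          frac A p (a \<otimes>\<^bsub>A\<^esub> d \<oplus>\<^bsub>A\<^esub> c \<otimes>\<^bsub>A\<^esub> b) (b \<otimes>\<^bsub>A\<^esub> d))\<rparr>),
     res = (\<lambda>U V s. restrict s V)\<rparr>"

definition Spec ::
  "('a, 'm) ring_scheme \<Rightarrow> ('a set, 'a set \<Rightarrow> ('a \<times> 'a) set) ringed_space"
  where "Spec A = frac_space A {p. primeideal p A} (carrier A \<times> carrier A)"

definition global_frac :: "('a, 'm) ring_scheme \<Rightarrow> 'a set set \<Rightarrow> 'a \<Rightarrow> 'a set \<Rightarrow> ('a \<times> 'a) set"
  where "global_frac A P a = (\<lambda>p\<in>P. frac A p a \<one>\<^bsub>A\<^esub>)"

text \<open>The polynomial ring over \<open>k\<close> in the variables \<open>x\<^sub>0, \<dots>, x\<^sub>n\<close>.  A polynomial is the function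
  giving its coefficients; a monomial is the multiset of its variables, so \<^const>\<open>size\<close> is its
  degree.\<close>

definition mpoly :: "'a ring \<Rightarrow> nat \<Rightarrow> (nat multiset \<Rightarrow> 'a) ring"
  where "mpoly k n =
    \<lparr>carrier = {f. (\<forall>m. f m \<in> carrier k) \<and> finite {m. f m \<noteq> \<zero>\<^bsub>k\<^esub>} \<and>
       (\<forall>m. f m \<noteq> \<zero>\<^bsub>k\<^esub> \<longrightarrow> set_mset m \<subseteq> {..n})},
     mult = (\<lambda>f g m. \<Oplus>\<^bsub>k\<^esub>a\<in>{a. a \<subseteq># m}. f a \<otimes>\<^bsub>k\<^esub> g (m - a)),
     one = (\<lambda>m. if m = {#} then \<one>\<^bsub>k\<^esub> else \<zero>\<^bsub>k\<^esub>),
     zero = (\<lambda>m. \<zero>\<^bsub>k\<^esub>),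
     add = (\<lambda>f g m. f m \<oplus>\<^bsub>k\<^esub> g m)\<rparr>"

definition mconst :: "'a ring \<Rightarrow> 'a \<Rightarrow> nat multiset \<Rightarrow> 'a"
  where "mconst k c = (\<lambda>m. if m = {#} then c else \<zero>\<^bsub>k\<^esub>)"

definition mcomponent :: "'a ring \<Rightarrow> nat \<Rightarrow> (nat multiset \<Rightarrow> 'a) \<Rightarrow> nat multiset \<Rightarrow> 'a"
  where "mcomponent k d f = (\<lambda>m. if size m = d then f m else \<zero>\<^bsub>k\<^esub>)"

definition proj_points :: "'a ring \<Rightarrow> nat \<Rightarrow> (nat multiset \<Rightarrow> 'a) set set"
  where "proj_points k n = {p. primeideal p (mpoly k n) \<and>
    (\<forall>f\<in>p. \<forall>d. mcomponent k d f \<in> p) \<and>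
    \<not> {f \<in> carrier (mpoly k n). f {#} = \<zero>\<^bsub>k\<^esub>} \<subseteq> p}"

definition proj_space ::
  "'a ring \<Rightarrow> nat \<Rightarrow> ((nat multiset \<Rightarrow> 'a) set,
     (nat multiset \<Rightarrow> 'a) set \<Rightarrow> ((nat multiset \<Rightarrow> 'a) \<times> (nat multiset \<Rightarrow> 'a)) set) ringed_space"
  where "proj_space k n = frac_space (mpoly k n) (proj_points k n)
    {(f, g). f \<in> carrier (mpoly k n) \<and> g \<in> carrier (mpoly k n) \<and>
       (\<exists>d. mcomponent k d f = f \<and> mcomponent k d g = g)}"


section \<open>Schemes and varieties over a field\<close>

definition affine_open :: "('p, 's, 'z) ringed_space_scheme \<Rightarrow> 'p set \<Rightarrow> bool"
  where "affine_open X U \<longleftrightarrow> openin (space X) U \<and>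
    (\<exists>(A :: 's ring) f. cring A \<and> isomorphism (open_sub X U) (Spec A) f)"

definition is_scheme :: "('p, 's, 'z) ringed_space_scheme \<Rightarrow> bool"
  where "is_scheme X \<longleftrightarrow> locally_ringed X \<and> (\<forall>x\<in>pts X. \<exists>U. x \<in> U \<and> affine_open X U)"

text \<open>
  A scheme over \<open>k\<close> has a structure morphism to \<open>Spec k\<close>.  To speak of all schemes over \<open>k\<close> one has
  to fix types for their points and sections.  If \<open>k\<close> has elements in \<open>'a\<close>, then in a scheme of
  finite type over \<open>k\<close> the points, and the sections over all open sets, number at most
  max(|k|, aleph 0), so up to isomorphism all of them, their products over \<open>k\<close>, and so on, have points
  and sections in \<open>'a list\<close>.
\<close>

record ('a, 'p, 's) over = "('p, 's) ringed_space" +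
  str :: "('p, 's, 'a set, 'a set \<Rightarrow> ('a \<times> 'a) set) mor"

type_synonym 'a sch = "('a, 'a list, 'a list) over"

definition kscheme :: "'a ring \<Rightarrow> 'a sch \<Rightarrow> bool"
  where "kscheme k X \<longleftrightarrow> is_scheme X \<and> morphism X (Spec k) (str X)"

definition kmor :: "'a ring \<Rightarrow> 'a sch \<Rightarrow> 'a sch \<Rightarrow> ('a list, 'a list, 'a list, 'a list) mor \<Rightarrow> bool"
  where "kmor k X Y f \<longleftrightarrow>
    morphism X Y f \<and> eq_mor X (Spec k) (comp_mor Y (str Y) f) (str X)"

definition kiso :: "'a ring \<Rightarrow> 'a sch \<Rightarrow> 'a sch \<Rightarrow> bool"
  where "kiso k X Y \<longleftrightarrow> (\<exists>f. isomorphism X Y f \<and> kmor k X Y f)"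

definition open_subscheme :: "'a sch \<Rightarrow> 'a list set \<Rightarrow> 'a sch"
  where "open_subscheme X U =
    \<lparr>space = subtopology (space X) U, sec = sec X, res = res X,
     str = comp_mor X (str X) (open_incl X U)\<rparr>"

text \<open>
  \<open>P\<close> with projections \<open>pr i\<close> is the product over \<open>Spec k\<close> of the schemes in the list \<open>Xs\<close>.
\<close>

definition fibre_product ::
  "'a ring \<Rightarrow> 'a sch list \<Rightarrow> 'a sch \<Rightarrow> (nat \<Rightarrow> ('a list, 'a list, 'a list, 'a list) mor) \<Rightarrow> bool"
  where "fibre_product k Xs P pr \<longleftrightarrow> kscheme k P \<and> (\<forall>i<length Xs. kmor k P (Xs ! i) (pr i)) \<and>
    (\<forall>T g. kscheme k T \<and> (\<forall>i<length Xs. kmor k T (Xs ! i) (g i)) \<longrightarrow>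
      (\<exists>h. kmor k T P h \<and>
         (\<forall>i<length Xs. eq_mor T (Xs ! i) (comp_mor P (pr i) h) (g i)) \<and>
         (\<forall>h'. kmor k T P h' \<and>
            (\<forall>i<length Xs. eq_mor T (Xs ! i) (comp_mor P (pr i) h') (g i)) \<longrightarrow>
            eq_mor T P h h')))"

definition separated :: "'a ring \<Rightarrow> 'a sch \<Rightarrow> bool"
  where "separated k X \<longleftrightarrow> (\<exists>P pr d. fibre_product k [X, X] P pr \<and> kmor k X P d \<and>
    eq_mor X X (comp_mor P (pr 0) d) id_mor \<and> eq_mor X X (comp_mor P (pr 1) d) id_mor \<and>
    closed_immersion X P d)"

definition scalar :: "'a ring \<Rightarrow> 'a sch \<Rightarrow> 'a list set \<Rightarrow> 'a \<Rightarrow> 'a list"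
  where "scalar k X U c =
    res X (pts X) U (pull (str X) (pts (Spec k)) (global_frac k (pts (Spec k)) c))"

definition finite_type :: "'a ring \<Rightarrow> 'a sch \<Rightarrow> bool"
  where "finite_type k X \<longleftrightarrow> (\<exists>\<U>. finite \<U> \<and> \<Union>\<U> = pts X \<and>
    (\<forall>U\<in>\<U>. affine_open X U \<and> (\<exists>E. finite E \<and> E \<subseteq> carrier (sec X U) \<and>
       generate_ring (sec X U) (scalar k X U ` carrier k \<union> E) = carrier (sec X U))))"

definition reduced :: "('p, 's, 'z) ringed_space_scheme \<Rightarrow> bool"
  where "reduced X \<longleftrightarrow> (\<forall>U s n. openin (space X) U \<and> s \<in> carrier (sec X U) \<and>
    s [^]\<^bsub>sec X U\<^esub> (n :: nat) = \<zero>\<^bsub>sec X U\<^esub> \<longrightarrow> s = \<zero>\<^bsub>sec X U\<^esub>)"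

definition variety :: "'a ring \<Rightarrow> 'a sch \<Rightarrow> bool"
  where "variety k X \<longleftrightarrow> kscheme k X \<and> reduced X \<and> separated k X \<and> finite_type k X"

definition is_reduction :: "'a ring \<Rightarrow> 'a sch \<Rightarrow> 'a sch \<Rightarrow> bool"
  where "is_reduction k V Z \<longleftrightarrow> kscheme k V \<and> reduced V \<and>
    (\<exists>r. kmor k V Z r \<and> closed_immersion V Z r \<and> pt r ` pts V = pts Z)"

text \<open>If \<open>k\<close> is not perfect, the product over \<open>Spec k\<close> of two varieties need not be reduced; as a
  variety, \<open>X \<times> Y\<close> is the reduction of this product.\<close>

definition is_product :: "'a ring \<Rightarrow> 'a sch \<Rightarrow> 'a sch \<Rightarrow> 'a sch \<Rightarrow> bool"
  where "is_product k X Y P \<longleftrightarrow> variety k P \<and>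
    (\<exists>Q pr. fibre_product k [X, Y] Q pr \<and> is_reduction k P Q)"

text \<open>\<open>permuting k X n P pr a \<sigma>\<close>: the automorphism \<open>a\<close> of the \<open>n\<close>-th power \<open>P\<close> of \<open>X\<close> permutes the
  factors by \<open>\<sigma>\<close>.\<close>

definition permuting ::
  "'a ring \<Rightarrow> 'a sch \<Rightarrow> nat \<Rightarrow> 'a sch \<Rightarrow> (nat \<Rightarrow> ('a list, 'a list, 'a list, 'a list) mor) \<Rightarrow>
    ('a list, 'a list, 'a list, 'a list) mor \<Rightarrow> (nat \<Rightarrow> nat) \<Rightarrow> bool"
  where "permuting k X n P pr a \<sigma> \<longleftrightarrow> \<sigma> permutes {..<n} \<and> kmor k P P a \<and>
    (\<forall>i<n. eq_mor P X (comp_mor P (pr i) a) (pr (\<sigma> i)))"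

text \<open>\<open>Q\<close> is the quotient of \<open>P\<close> by the symmetric group as a ringed space: its space is the space of
  orbits and its structure sheaf consists of the invariant sections on \<open>P\<close>.\<close>

definition symmetric_quotient ::
  "'a ring \<Rightarrow> 'a sch \<Rightarrow> nat \<Rightarrow> 'a sch \<Rightarrow> (nat \<Rightarrow> ('a list, 'a list, 'a list, 'a list) mor) \<Rightarrow>
    'a sch \<Rightarrow> ('a list, 'a list, 'a list, 'a list) mor \<Rightarrow> bool"
  where "symmetric_quotient k X n P pr Q \<pi> \<longleftrightarrow> kscheme k Q \<and> kmor k P Q \<pi> \<and>
    quotient_map (space P) (space Q) (pt \<pi>) \<and>
    (\<forall>x\<in>pts P. \<forall>y\<in>pts P.
       pt \<pi> x = pt \<pi> y \<longleftrightarrow> (\<exists>\<sigma> a. permuting k X n P pr a \<sigma> \<and> pt a x = y)) \<and>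
    (\<forall>V. openin (space Q) V \<longrightarrow> inj_on (pull \<pi> V) (carrier (sec Q V)) \<and>
       pull \<pi> V ` carrier (sec Q V) =
         {s \<in> carrier (sec P (preim P \<pi> V)).
            \<forall>\<sigma> a. permuting k X n P pr a \<sigma> \<longrightarrow> pull a (preim P \<pi> V) s = s})"

definition symmetric_product :: "'a ring \<Rightarrow> nat \<Rightarrow> 'a sch \<Rightarrow> 'a sch \<Rightarrow> bool"
  where "symmetric_product k n X S \<longleftrightarrow> variety k S \<and>
    (\<exists>P pr Q \<pi>. fibre_product k (replicate n X) P pr \<and> symmetric_quotient k X n P pr Q \<pi> \<and>
       is_reduction k S Q)"

text \<open>A quasi-projective variety is a closed subscheme of an open subscheme \<open>U\<close> of some projective
  space.  The structure morphism \<open>g\<close> of the latter is determined by its effect on constants.\<close>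

definition quasi_projective :: "'a ring \<Rightarrow> 'a sch \<Rightarrow> bool"
  where "quasi_projective k X \<longleftrightarrow> variety k X \<and>
    (\<exists>n g U f. morphism (proj_space k n) (Spec k) g \<and>
       (\<forall>c\<in>carrier k. pull g (pts (Spec k)) (global_frac k (pts (Spec k)) c) =
          global_frac (mpoly k n) (pts (proj_space k n)) (mconst k c)) \<and>
       openin (space (proj_space k n)) U \<and>
       closed_immersion X (open_sub (proj_space k n) U) f \<and>
       eq_mor X (Spec k)
         (comp_mor (proj_space k n) g
           (comp_mor (open_sub (proj_space k n) U) (open_incl (proj_space k n) U) f))
         (str X))"

definition residue_field ::
  "('p, 's, 'z) ringed_space_scheme \<Rightarrow> 'p \<Rightarrow> ('p set \<times> 's) set set ring"
  where "residue_field X x = stalk X x Quot (THE I. maximalideal I (stalk X x))"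

definition residue_map ::
  "('p, 's, 'z) ringed_space_scheme \<Rightarrow> ('p, 's, 'q, 't) mor \<Rightarrow> 'p \<Rightarrow>
    ('q set \<times> 't) set set \<Rightarrow> ('p set \<times> 's) set set"
  where "residue_map X f x A =
    (\<Union>a\<in>A. (THE I. maximalideal I (stalk X x)) +>\<^bsub>stalk X x\<^esub> stalk_map X f x a)"

text \<open>A morphism of schemes of characteristic \<open>p\<close> is radicial if it is injective on points with purely
  inseparable residue field extensions.\<close>

definition radicial ::
  "nat \<Rightarrow> ('p, 's, 'z) ringed_space_scheme \<Rightarrow> ('q, 't, 'y) ringed_space_scheme \<Rightarrow>
    ('p, 's, 'q, 't) mor \<Rightarrow> bool"
  where "radicial p X Y f \<longleftrightarrow> inj_on (pt f) (pts X) \<and>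
    (\<forall>x\<in>pts X. \<forall>a\<in>carrier (residue_field X x). \<exists>j::nat.
       a [^]\<^bsub>residue_field X x\<^esub> (p ^ j) \<in> residue_map X f x ` carrier (residue_field Y (pt f x)))"


section \<open>The Grothendieck ring of varieties\<close>

definition iso_class :: "'a ring \<Rightarrow> 'a sch \<Rightarrow> 'a sch set"
  where "iso_class k X = {Y. variety k Y \<and> kiso k X Y}"

definition class_group :: "'a ring \<Rightarrow> ('a sch set \<Rightarrow>\<^sub>0 int) monoid"
  where "class_group k = free_Abelian_group (iso_class k ` {X. variety k X})"

definition relations :: "'a ring \<Rightarrow> ('a sch set \<Rightarrow>\<^sub>0 int) set"
  where "relations k =
    {frag_of (iso_class k X) - (frag_of (iso_class k Y) +
       frag_of (iso_class k (open_subscheme X (pts X - pt i ` pts Y)))) | X Y i.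
       variety k X \<and> variety k Y \<and> kmor k Y X i \<and> closed_immersion Y X i} \<union>
    {frag_of (iso_class k X) - frag_of (iso_class k Y) | X Y f p.
       prime (p :: nat) \<and> [p] \<cdot>\<^bsub>k\<^esub> \<one>\<^bsub>k\<^esub> = \<zero>\<^bsub>k\<^esub> \<and> variety k X \<and> variety k Y \<and>
       kmor k X Y f \<and> pt f ` pts X = pts Y \<and> radicial p X Y f}"

definition K0_group :: "'a ring \<Rightarrow> ('a sch set \<Rightarrow>\<^sub>0 int) set monoid"
  where "K0_group k = class_group k Mod generate (class_group k) (relations k)"

definition K0_class :: "'a ring \<Rightarrow> 'a sch \<Rightarrow> ('a sch set \<Rightarrow>\<^sub>0 int) set"
  where "K0_class k X =
    generate (class_group k) (relations k) #>\<^bsub>class_group k\<^esub> frag_of (iso_class k X)"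

text \<open>\<open>K\<close> is the ring on this group with the multiplication induced by the product of varieties.
  Since the classes of varieties generate the group, at most one multiplication (with its unit)
  satisfies this.\<close>

definition is_K0Var :: "'a ring \<Rightarrow> ('a sch set \<Rightarrow>\<^sub>0 int) set ring \<Rightarrow> bool"
  where "is_K0Var k K \<longleftrightarrow> cring K \<and>
    carrier K = carrier (K0_group k) \<and> add K = mult (K0_group k) \<and> zero K = one (K0_group k) \<and>
    (\<forall>X Y P. variety k X \<and> variety k Y \<and> is_product k X Y P \<longrightarrow>
       K0_class k X \<otimes>\<^bsub>K\<^esub> K0_class k Y = K0_class k P)"

definition motivic_measure ::
  "('a sch set \<Rightarrow>\<^sub>0 int) set ring \<Rightarrow> 'r ring \<Rightarrow> (('a sch set \<Rightarrow>\<^sub>0 int) set \<Rightarrow> 'r) \<Rightarrow> bool"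
  where "motivic_measure K R \<mu> \<longleftrightarrow> \<mu> \<in> ring_hom K R"


section \<open>The big Witt ring\<close>

text \<open>Power series are their coefficient functions, as in \<^const>\<open>UP\<close>; in particular \<^term>\<open>up R\<close> is the
  set of polynomials.\<close>

definition power_series :: "'r ring \<Rightarrow> (nat \<Rightarrow> 'r) ring"
  where "power_series R =
    \<lparr>carrier = UNIV \<rightarrow> carrier R,
     mult = (\<lambda>f g n. \<Oplus>\<^bsub>R\<^esub>i\<in>{..n}. f i \<otimes>\<^bsub>R\<^esub> g (n - i)),
     one = (\<lambda>n. if n = 0 then \<one>\<^bsub>R\<^esub> else \<zero>\<^bsub>R\<^esub>),
     zero = (\<lambda>n. \<zero>\<^bsub>R\<^esub>),
     add = (\<lambda>f g n. f n \<oplus>\<^bsub>R\<^esub> g n)\<rparr>"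

text \<open>The series \<open>1/(1 - c t\<^sup>m)\<close>, for \<open>m > 0\<close>.\<close>

definition geo :: "'r ring \<Rightarrow> nat \<Rightarrow> 'r \<Rightarrow> nat \<Rightarrow> 'r"
  where "geo R m c = (\<lambda>j. if m dvd j then c [^]\<^bsub>R\<^esub> (j div m) else \<zero>\<^bsub>R\<^esub>)"

text \<open>Every power series with constant term 1 is uniquely of the form
  \<open>\<Prod>m\<ge>1. 1/(1 - a\<^sub>m t\<^sup>m)\<close>.  The factors with \<open>m > n\<close> do not affect the coefficient of \<open>t\<^sup>n\<close>.\<close>

definition witt_components :: "'r ring \<Rightarrow> (nat \<Rightarrow> 'r) \<Rightarrow> nat \<Rightarrow> 'r"
  where "witt_components R f = (THE a. a \<in> UNIV \<rightarrow> carrier R \<and> a 0 = \<zero>\<^bsub>R\<^esub> \<and>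
    (\<forall>n. f n = (\<Otimes>\<^bsub>power_series R\<^esub>m\<in>{1..n}. geo R m (a m)) n))"

text \<open>
  The Witt product is biadditive, i.e. distributes over the infinite products above, and satisfies
  \<open>1/(1 - a t\<^sup>m) * 1/(1 - b t\<^sup>n) = (1/(1 - a\<^bsup>n/d\<^esup> b\<^bsup>m/d\<^esup> t\<^bsup>mn/d\<^esup>))\<^bsup>d\<^esup>\<close> with \<open>d = gcd m n\<close>.  The latter comes
  from the rule for \<open>m = n = 1\<close> and functoriality, by splitting \<open>1 - a t\<^sup>m\<close> and \<open>1 - b t\<^sup>n\<close> into
  linear factors.  Again the coefficient of \<open>t\<^sup>N\<close> only involves \<open>m, n \<le> N\<close>.
\<close>

definition witt_mult :: "'r ring \<Rightarrow> (nat \<Rightarrow> 'r) \<Rightarrow> (nat \<Rightarrow> 'r) \<Rightarrow> nat \<Rightarrow> 'r"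
  where "witt_mult R f g = (\<lambda>N.
    (\<Otimes>\<^bsub>power_series R\<^esub>m\<in>{1..N}. \<Otimes>\<^bsub>power_series R\<^esub>n\<in>{1..N}.
       geo R (lcm m n)
         (witt_components R f m [^]\<^bsub>R\<^esub> (n div gcd m n) \<otimes>\<^bsub>R\<^esub>
          witt_components R g n [^]\<^bsub>R\<^esub> (m div gcd m n))
       [^]\<^bsub>power_series R\<^esub> gcd m n) N)"

definition big_witt :: "'r ring \<Rightarrow> (nat \<Rightarrow> 'r) ring"
  where "big_witt R =
    \<lparr>carrier = {f \<in> UNIV \<rightarrow> carrier R. f 0 = \<one>\<^bsub>R\<^esub>},
     mult = witt_mult R,
     one = geo R 1 \<one>\<^bsub>R\<^esub>,
     zero = one (power_series R),
     add = mult (power_series R)\<rparr>"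

definition witt_rational :: "'r ring \<Rightarrow> (nat \<Rightarrow> 'r) set"
  where "witt_rational R = {p \<ominus>\<^bsub>big_witt R\<^esub> q | p q.
    p \<in> up R \<and> q \<in> up R \<and> p 0 = \<one>\<^bsub>R\<^esub> \<and> q 0 = \<one>\<^bsub>R\<^esub>}"


section \<open>Kapranov's zeta function\<close>

definition kapranov_zeta ::
  "'a ring \<Rightarrow> ('a sch set \<Rightarrow>\<^sub>0 int) set ring \<Rightarrow> 'r ring \<Rightarrow> (('a sch set \<Rightarrow>\<^sub>0 int) set \<Rightarrow> 'r) \<Rightarrow>
    ('a sch set \<Rightarrow>\<^sub>0 int) set \<Rightarrow> nat \<Rightarrow> 'r"
  where "kapranov_zeta k K R \<mu> = (THE Z. Z \<in> extensional (carrier K) \<and>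
    Z \<in> hom (add_monoid K) (add_monoid (big_witt R)) \<and>
    (\<forall>X S. quasi_projective k X \<and> (\<forall>n. symmetric_product k n X (S n)) \<longrightarrow>
       Z (K0_class k X) = (\<lambda>n. \<mu> (K0_class k (S n)))))"

definition can_be_exponentiated ::
  "'a ring \<Rightarrow> ('a sch set \<Rightarrow>\<^sub>0 int) set ring \<Rightarrow> 'r ring \<Rightarrow> (('a sch set \<Rightarrow>\<^sub>0 int) set \<Rightarrow> 'r) \<Rightarrow> bool"
  where "can_be_exponentiated k K R \<mu> \<longleftrightarrow> kapranov_zeta k K R \<mu> \<in> ring_hom K (big_witt R)"

end

theory Submission
  imports Defs "HOL-Algebra.Algebraic_Closure_Type"
    "HOL-Computational_Algebra.Computational_Algebra"
begin

text \<open>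
  The zeta function of a product is the Witt product of the zeta functions, so it suffices that
  Witt products of rational functions are rational.  All coefficients involved are images of
  variables of the polynomial ring \<open>A = \<int>[x\<^sub>0, x\<^sub>1, \<dots>]\<close>, and the Witt product is given by universal
  formulas, so one may work over \<open>A\<close>, hence inside the algebraic closure \<open>L\<close> of its fraction field.
  As \<open>L\<close> has characteristic 0, a series with constant term 1 is determined by its logarithmic
  derivative, and the Witt product multiplies the coefficients of \<open>t f'/f\<close>; this gives
  biadditivity.  Polynomials split over \<open>L\<close>, and the Witt product of \<open>\<Prod>(1 - a\<^sub>i t)\<close> and
  \<open>\<Prod>(1 - b\<^sub>j t)\<close> is the inverse of the polynomial \<open>\<Prod>(1 - a\<^sub>i b\<^sub>j t)\<close>, whose coefficients lie
  in \<open>A\<close> because the Witt product is defined over \<open>A\<close>.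
\<close>

section \<open>Witt components and Witt products over a type class\<close>

unbundle fps_syntax

section \<open>Congruence of power series modulo \<open>t ^ (N + 1)\<close>\<close>

definition fps_agree :: "nat \<Rightarrow> 'a fps \<Rightarrow> 'a fps \<Rightarrow> bool"
  where "fps_agree N f g \<longleftrightarrow> (\<forall>i\<le>N. fps_nth f i = fps_nth g i)"

lemma fps_agree_refl [simp]: "fps_agree N f f"
  by (simp add: fps_agree_def)

lemma fps_agree_mult:
  fixes f g :: "'a :: comm_ring_1 fps"
  shows "fps_agree N f f' \<Longrightarrow> fps_agree N g g' \<Longrightarrow> fps_agree N (f * g) (f' * g')"
  by (auto simp: fps_agree_def fps_mult_nth intro!: sum.cong)

lemma fps_agree_prod:
  fixes f g :: "'b \<Rightarrow> 'a :: comm_ring_1 fps"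
  shows "(\<And>i. i \<in> I \<Longrightarrow> fps_agree N (f i) (g i)) \<Longrightarrow> fps_agree N (prod f I) (prod g I)"
  by (induction I rule: infinite_finite_induct) (auto intro: fps_agree_mult)

lemma fps_agree_power:
  fixes f g :: "'a :: comm_ring_1 fps"
  shows "fps_agree N f g \<Longrightarrow> fps_agree N (f ^ n) (g ^ n)"
  by (induction n) (auto intro: fps_agree_mult)

text \<open>The additional factors are congruent to 1 and may be replaced by 1. This lets products
  truncated at different places be compared coefficient by coefficient.\<close>

lemma fps_agree_prod_mono:
  fixes f :: "'b \<Rightarrow> 'a :: comm_ring_1 fps"
  assumes "finite J" "I \<subseteq> J" "\<And>i. i \<in> J - I \<Longrightarrow> fps_agree N (f i) 1"
  shows "fps_agree N (prod f I) (prod f J)"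
proof -
  have "prod f J = prod f I * prod f (J - I)"
    using assms by (simp add: prod.subset_diff mult.commute)
  moreover have "fps_agree N (prod f I * prod (\<lambda>_. 1) (J - I)) (prod f I * prod f (J - I))"
    using assms(3) by (intro fps_agree_mult fps_agree_prod) (auto simp: fps_agree_def)
  ultimately show ?thesis by simp
qed

text \<open>
  \<open>fps_geo\<close>, \<open>has_witt_comps\<close> and \<open>witt_prod\<close> correspond to \<^const>\<open>geo\<close>, \<^const>\<open>witt_components\<close> and
  \<^const>\<open>witt_mult\<close>; the arguments of \<open>witt_prod\<close> are the components of the factors.
\<close>

definition fps_geo :: "nat \<Rightarrow> 'a :: comm_ring_1 \<Rightarrow> 'a fps"
  where "fps_geo m c = Abs_fps (\<lambda>j. if m dvd j then c ^ (j div m) else 0)"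

lemma fps_geo_nth: "fps_geo m c $ j = (if m dvd j then c ^ (j div m) else 0)"
  by (simp add: fps_geo_def)

lemma fps_geo_nth_0 [simp]: "fps_geo m c $ 0 = 1"
  by (simp add: fps_geo_nth)

lemma agree_fps_geo: "N < m \<Longrightarrow> fps_agree N (fps_geo m c) 1"
  by (auto simp: fps_agree_def fps_geo_nth dest: dvd_imp_le)

text \<open>Multiplication by \<open>c t^m\<close> shifts the geometric series by one period, so the
  difference telescopes to its constant term.\<close>

lemma fps_geo_inverse:
  assumes "m > 0"
  shows "fps_geo m c * (1 - fps_const c * fps_X ^ m) = 1"
proof (rule fps_ext)
  fix n
  have "fps_geo m c * (1 - fps_const c * fps_X ^ m) = fps_geo m c - fps_const c * (fps_geo m c * fps_X ^ m)"
    by (simp add: algebra_simps)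
  moreover have "(fps_geo m c - fps_const c * (fps_geo m c * fps_X ^ m)) $ n = (1 :: 'a fps) $ n"
  proof (cases "n < m")
    case True
    then show ?thesis
      by (cases "n = 0") (auto simp: fps_X_power_mult_right_nth fps_geo_nth dest: dvd_imp_le)
  next
    case False
    then have eq: "m dvd n - m \<longleftrightarrow> m dvd n"
      by (metis dvd_diffD1 dvd_minus_self dvd_refl leI)
    have "n div m = Suc ((n - m) div m)"
      using False assms by (simp add: le_div_geq)
    then show ?thesis
      using False assms by (auto simp: fps_X_power_mult_right_nth fps_geo_nth eq)
  qed
  ultimately show "(fps_geo m c * (1 - fps_const c * fps_X ^ m)) $ n = (1 :: 'a fps) $ n"
    by simp
qed

definition has_witt_comps :: "'a :: comm_ring_1 fps \<Rightarrow> (nat \<Rightarrow> 'a) \<Rightarrow> bool"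
  where "has_witt_comps F a \<longleftrightarrow> a 0 = 0 \<and> (\<forall>n. F $ n = (\<Prod>m\<in>{1..n}. fps_geo m (a m)) $ n)"

text \<open>The Witt product of the single factors \<open>fps_geo m (a m)\<close> and
  \<open>fps_geo n (b n)\<close>.\<close>

definition witt_factor :: "(nat \<Rightarrow> 'a :: comm_ring_1) \<Rightarrow> (nat \<Rightarrow> 'a) \<Rightarrow> nat \<Rightarrow> nat \<Rightarrow> 'a fps"
  where "witt_factor a b m n = fps_geo (lcm m n) (a m ^ (n div gcd m n) * b n ^ (m div gcd m n)) ^ gcd m n"

definition witt_prod :: "(nat \<Rightarrow> 'a :: comm_ring_1) \<Rightarrow> (nat \<Rightarrow> 'a) \<Rightarrow> 'a fps"
  where "witt_prod a b = Abs_fps (\<lambda>N. (\<Prod>m\<in>{1..N}. \<Prod>n\<in>{1..N}. witt_factor a b m n) $ N)"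

lemma fps_prod_nth_0:
  fixes f :: "'b \<Rightarrow> 'a :: comm_ring_1 fps"
  shows "(\<And>i. i \<in> I \<Longrightarrow> f i $ 0 = 1) \<Longrightarrow> prod f I $ 0 = 1"
  by (induction I rule: infinite_finite_induct) auto

lemma witt_factor_nth_0 [simp]: "witt_factor a b m n $ 0 = 1"
  by (simp add: witt_factor_def fps_power_zeroth)

lemma witt_prod_nth_0 [simp]: "witt_prod a b $ 0 = 1"
  by (simp add: witt_prod_def)

lemma has_witt_comps_nth_0: "has_witt_comps F a \<Longrightarrow> F $ 0 = 1"
  by (simp add: has_witt_comps_def)

text \<open>In \<open>has_witt_comps\<close> each coefficient has its own finite product. Factors of
  index above \<open>i\<close> are 1 modulo \<open>t^(i+1)\<close>, so one product serves all
  coefficients up to \<open>N\<close>.\<close>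

lemma has_witt_comps_agree:
  assumes "has_witt_comps F a"
  shows "fps_agree N F (\<Prod>m\<in>{1..N}. fps_geo m (a m))"
  unfolding fps_agree_def
proof (intro allI impI)
  fix i assume "i \<le> N"
  then have "fps_agree i (\<Prod>m\<in>{1..i}. fps_geo m (a m)) (\<Prod>m\<in>{1..N}. fps_geo m (a m))"
    by (intro fps_agree_prod_mono) (auto intro: agree_fps_geo)
  then show "F $ i = (\<Prod>m\<in>{1..N}. fps_geo m (a m)) $ i"
    using assms by (simp add: has_witt_comps_def fps_agree_def)
qed

text \<open>The first nonconstant term sits in degree at least \<open>lcm m n\<close>, which exceeds
  \<open>N\<close> as soon as \<open>m\<close> or \<open>n\<close> does.\<close>

lemma agree_witt_factor:
  assumes "m \<ge> 1" "n \<ge> 1" "N < m \<or> N < n"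
  shows "fps_agree N (witt_factor a b m n) 1"
proof -
  have "m \<le> lcm m n" "n \<le> lcm m n"
    using assms by (auto intro!: dvd_imp_le simp: lcm_pos_nat)
  then have "N < lcm m n" using assms by linarith
  then have "fps_agree N (witt_factor a b m n) (1 ^ gcd m n)"
    unfolding witt_factor_def by (intro fps_agree_power agree_fps_geo)
  then show ?thesis by simp
qed

lemma witt_prod_agree: "fps_agree N (witt_prod a b) (\<Prod>m\<in>{1..N}. \<Prod>n\<in>{1..N}. witt_factor a b m n)"
  unfolding fps_agree_def
proof (intro allI impI)
  fix i assume "i \<le> N"
  \<comment> \<open>The double products become products over squares of index pairs, so that one
    enlargement of the index set suffices.\<close>
  then have "fps_agree i (\<Prod>x\<in>{1..i}\<times>{1..i}. witt_factor a b (fst x) (snd x)) (\<Prod>x\<in>{1..N}\<times>{1..N}. witt_factor a b (fst x) (snd x))"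
    by (intro fps_agree_prod_mono) (auto intro: agree_witt_factor)
  then show "witt_prod a b $ i = (\<Prod>m\<in>{1..N}. \<Prod>n\<in>{1..N}. witt_factor a b m n) $ i"
    by (simp add: witt_prod_def fps_agree_def prod.cartesian_product split_def)
qed

text \<open>Solves for the components one after another: component \<open>n\<close> is the
  discrepancy in coefficient \<open>n\<close> left by the factors of smaller index.\<close>

fun witt_comps :: "'a :: comm_ring_1 fps \<Rightarrow> nat \<Rightarrow> 'a"
  where "witt_comps F n = (if n = 0 then 0 else F $ n - (\<Prod>m\<in>{1..<n}. fps_geo m (witt_comps F m)) $ n)"

declare witt_comps.simps [simp del]

text \<open>Modulo \<open>t^(n+1)\<close> the last factor is \<open>1 + a n t^n\<close>, and it
  multiplies a series with constant term 1.\<close>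

lemma prod_fps_geo_step:
  assumes "n > 0"
  shows "(\<Prod>m\<in>{1..n}. fps_geo m (a m)) $ n = (\<Prod>m\<in>{1..<n}. fps_geo m (a m)) $ n + a n"
proof -
  have "fps_agree n (fps_geo n (a n)) (1 + fps_const (a n) * fps_X ^ n)"
    using assms by (auto simp: fps_agree_def fps_geo_nth dest: dvd_imp_le)
  then have "fps_agree n ((\<Prod>m\<in>{1..<n}. fps_geo m (a m)) * fps_geo n (a n))
      ((\<Prod>m\<in>{1..<n}. fps_geo m (a m)) * (1 + fps_const (a n) * fps_X ^ n))"
    by (intro fps_agree_mult) auto
  moreover have "{1..n} = insert n {1..<n}" using assms by auto
  moreover have "(\<Prod>m\<in>{1..<n}. fps_geo m (a m)) $ 0 = 1"
    by (rule fps_prod_nth_0) auto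
  ultimately show ?thesis
    by (simp add: fps_agree_def algebra_simps fps_X_power_mult_nth)
qed

lemma has_witt_comps_witt_comps: "F $ 0 = 1 \<Longrightarrow> has_witt_comps F (witt_comps F)"
  unfolding has_witt_comps_def
proof (intro conjI allI)
  show "witt_comps F 0 = 0" by (simp add: witt_comps.simps)
  fix n assume "F $ 0 = 1"
  then show "F $ n = (\<Prod>m\<in>{1..n}. fps_geo m (witt_comps F m)) $ n"
    by (cases "n = 0") (simp_all add: prod_fps_geo_step witt_comps.simps[of F n] del: One_nat_def)
qed

section \<open>Logarithmic derivatives\<close>

text \<open>The coefficient of \<open>t\<^sup>N\<close> in \<open>f'/f\<close> is the ghost component of \<open>f\<close> of index \<open>N + 1\<close>.\<close>

definition log_deriv :: "'a :: field fps \<Rightarrow> 'a fps"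
  where "log_deriv f = fps_deriv f * inverse f"

lemma log_deriv_1 [simp]: "log_deriv 1 = 0"
  by (simp add: log_deriv_def)

lemma log_deriv_mult:
  assumes "f $ 0 = 1" "g $ 0 = (1 :: 'a :: field)"
  shows "log_deriv (f * g) = log_deriv f + log_deriv g"
proof -
  have "f * inverse f = 1" "g * inverse g = 1"
    using assms by (auto intro: inverse_mult_eq_1')
  moreover have "log_deriv (f * g) = log_deriv f * (g * inverse g) + log_deriv g * (f * inverse f)"
    by (simp add: log_deriv_def fps_inverse_mult algebra_simps)
  ultimately show ?thesis by simp
qed

lemma log_deriv_prod: "(\<And>i. i \<in> I \<Longrightarrow> f i $ 0 = (1 :: 'a :: field)) \<Longrightarrow> log_deriv (prod f I) = (\<Sum>i\<in>I. log_deriv (f i))"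
  by (induction I rule: infinite_finite_induct) (auto simp: log_deriv_mult fps_prod_nth_0)

lemma log_deriv_power: "f $ 0 = (1 :: 'a :: field) \<Longrightarrow> log_deriv (f ^ n) = of_nat n * log_deriv f"
  by (induction n) (auto simp: log_deriv_mult fps_power_zeroth algebra_simps)

text \<open>The equation forces \<open>g $ 0 = 1\<close>, so additivity applies and the two
  logarithmic derivatives add up to that of 1.\<close>

lemma log_deriv_inverse_unique: "f * g = 1 \<Longrightarrow> f $ 0 = (1 :: 'a :: field) \<Longrightarrow> log_deriv f = - log_deriv g"
  by (metis add.commute add_eq_0_iff log_deriv_1 log_deriv_mult fps_mult_nth_0 fps_one_nth mult_1)

lemma fps_deriv_conv: "f $ 0 = (1 :: 'a :: field) \<Longrightarrow> fps_deriv f = log_deriv f * f"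
  by (simp add: log_deriv_def mult.assoc inverse_mult_eq_1)

text \<open>The quotient of the two series has logarithmic derivative 0, hence derivative 0. In
  characteristic 0 it is therefore constant, equal to 1.\<close>

lemma log_deriv_eqD:
  fixes f :: "'a :: field_char_0 fps"
  assumes "log_deriv f = log_deriv g" "f $ 0 = 1" "g $ 0 = 1"
  shows "f = g"
proof -
  have inv: "g * inverse g = 1" using assms by (auto intro: inverse_mult_eq_1')
  have i0: "inverse g $ 0 = 1" using assms by simp
  have "log_deriv (f * inverse g) = 0"
    using assms log_deriv_inverse_unique[OF inv] by (simp add: log_deriv_mult)
  then have "fps_deriv (f * inverse g) = 0"
    using assms fps_deriv_conv[of "f * inverse g"] by (simp del: fps_deriv_mult)
  then have "f * inverse g = 1"
    using assms i0 by (simp add: fps_deriv_eq_0_iff del: fps_deriv_mult)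
  then show ?thesis using inv
    by (metis mult.assoc mult.commute mult_1)
qed

text \<open>Differentiation lowers the index by one, so agreement up to \<open>Suc N\<close> is
  needed to obtain agreement up to \<open>N\<close>.\<close>

lemma agree_log_deriv:
  assumes "fps_agree (Suc N) f g" "f $ 0 = 1" "g $ 0 = (1 :: 'a :: field)"
  shows "fps_agree N (log_deriv f) (log_deriv g)"
  unfolding fps_agree_def
proof (intro allI impI)
  fix i assume "i \<le> N"
  then show "log_deriv f $ i = log_deriv g $ i"
  proof (induction i rule: less_induct)
    case (less i)
    \<comment> \<open>Newton's recursion, read off from \<open>h' = log_deriv h * h\<close>: the
      summand \<open>j = i\<close> has the factor \<open>h $ 0 = 1\<close> and is isolated.\<close>
    have eq: "log_deriv h $ i = fps_deriv h $ i - (\<Sum>j<i. log_deriv h $ j * h $ (i - j))" if "h $ 0 = 1" for h :: "'a fps"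
    proof -
      have "fps_deriv h $ i = (\<Sum>j=0..i. log_deriv h $ j * h $ (i - j))"
        using that by (subst fps_deriv_conv) (auto simp: fps_mult_nth)
      also have "{0..i} = insert i {..<i}" by auto
      finally show ?thesis using that by simp
    qed
    show ?case
      unfolding eq[OF assms(2)] eq[OF assms(3)] using assms(1) less
      by (auto simp: fps_agree_def intro!: sum.cong)
  qed
qed

section \<open>Ghost components of geometric series and of Witt products\<close>

text \<open>The logarithmic derivative of \<open>1/(1 - c t^m)\<close> is
  \<open>m c t^(m-1) / (1 - c t^m)\<close>; the exponent \<open>m - 1\<close> is why divisibility is
  tested at \<open>Suc N\<close>.\<close>

lemma log_deriv_fps_geo:
  assumes "m > 0"
  shows "log_deriv (fps_geo m (c :: 'a :: field)) $ N = (if m dvd Suc N then of_nat m * c ^ (Suc N div m) else 0)"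
proof -
  let ?g = "1 - fps_const c * fps_X ^ m"
  have inv: "fps_geo m c * ?g = 1" using fps_geo_inverse[OF assms] .
  have g0: "?g $ 0 = 1" using assms by simp
  have ig: "inverse ?g = fps_geo m c"
    using inv g0 by (metis fps_inverse_unique mult.commute)
  have "log_deriv (fps_geo m c) = - log_deriv ?g" using inv by (intro log_deriv_inverse_unique) auto
  also have "\<dots> = fps_const (of_nat m * c) * fps_X ^ (m - 1) * fps_geo m c"
    unfolding log_deriv_def ig by (simp add: fps_deriv_power algebra_simps flip: fps_const_mult)
  also have "\<dots> = fps_const (of_nat m * c) * (fps_X ^ (m - 1) * fps_geo m c)"
    by (simp only: mult.assoc)
  finally have *: "log_deriv (fps_geo m c) $ N = of_nat m * c * (if N < m - 1 then 0 else fps_geo m c $ (N - (m - 1)))"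
    by (simp add: fps_X_power_mult_nth)
  show ?thesis
  proof (cases "Suc N < m")
    case True
    then show ?thesis unfolding * by (auto dest: dvd_imp_le)
  next
    case False
    then have "N - (m - 1) = Suc N - m" using assms by simp
    moreover have "m dvd Suc N - m \<longleftrightarrow> m dvd Suc N"
      using False by (metis dvd_diffD1 dvd_minus_self dvd_refl leI)
    moreover have "Suc N div m = Suc ((Suc N - m) div m)"
      using False assms by (simp add: le_div_geq)
    ultimately show ?thesis unfolding * using False assms by (auto simp: fps_geo_nth)
  qed
qed

text \<open>The classical ghost component: the sum of \<open>d * a d ^ (n div d)\<close> over the
  divisors \<open>d\<close> of \<open>n = Suc N\<close>. It follows from additivity on the product
  truncated at \<open>Suc N\<close>.\<close>

lemma log_deriv_has_witt_comps:
  fixes F :: "'a :: field fps"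
  assumes "has_witt_comps F a"
  shows "log_deriv F $ N = (\<Sum>m\<in>{1..Suc N}. if m dvd Suc N then of_nat m * a m ^ (Suc N div m) else 0)"
proof -
  have "fps_agree N (log_deriv F) (log_deriv (\<Prod>m\<in>{1..Suc N}. fps_geo m (a m)))"
    using has_witt_comps_agree[OF assms, of "Suc N"] has_witt_comps_nth_0[OF assms]
    by (intro agree_log_deriv) (auto intro: fps_prod_nth_0)
  then have "log_deriv F $ N = (\<Sum>m\<in>{1..Suc N}. log_deriv (fps_geo m (a m)) $ N)"
    by (simp add: fps_agree_def log_deriv_prod fps_sum_nth del: prod.cl_ivl_Suc sum.cl_ivl_Suc)
  also have "\<dots> = (\<Sum>m\<in>{1..Suc N}. if m dvd Suc N then of_nat m * a m ^ (Suc N div m) else 0)"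
    by (intro sum.cong) (auto simp: log_deriv_fps_geo)
  finally show ?thesis .
qed

text \<open>If \<open>m\<close> and \<open>n\<close> both divide \<open>Suc N\<close>, so does
  \<open>lcm m n\<close>, and \<open>gcd m n * lcm m n = m * n\<close> makes the leading factors
  match. Otherwise both sides vanish.\<close>

lemma log_deriv_witt_factor:
  fixes a b :: "nat \<Rightarrow> 'a :: field"
  assumes "m > 0" "n > 0"
  shows "log_deriv (witt_factor a b m n) $ N =
    (if m dvd Suc N then of_nat m * a m ^ (Suc N div m) else 0) *
    (if n dvd Suc N then of_nat n * b n ^ (Suc N div n) else 0)"
proof (cases "m dvd Suc N \<and> n dvd Suc N")
  case True
  then have l: "lcm m n dvd Suc N" by simp
  then obtain q where q: "Suc N = lcm m n * q" unfolding dvd_def by blast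
  have lpos: "lcm m n > 0" using assms by (simp add: lcm_pos_nat)
  have gl: "gcd m n * lcm m n = m * n" by (rule prod_gcd_lcm_nat[symmetric])
  have "lcm m n = m * (n div gcd m n)" "lcm m n = n * (m div gcd m n)"
    by (simp_all add: lcm_nat_def div_mult_swap dvd_div_mult mult.commute)
  \<comment> \<open>These identities match the exponents of \<open>a m\<close> and
    \<open>b n\<close> inside \<open>witt_factor\<close> with those of the claim.\<close>
  then have "Suc N div m = (n div gcd m n) * (Suc N div lcm m n)"
    "Suc N div n = (m div gcd m n) * (Suc N div lcm m n)"
    using lpos assms unfolding q by (metis mult.assoc nonzero_mult_div_cancel_left less_numeral_extra(3))+
  moreover have "of_nat m * of_nat n = (of_nat (gcd m n) * of_nat (lcm m n) :: 'a)"
    using gl by (metis of_nat_mult)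
  ultimately show ?thesis
    using True l lpos
    by (simp add: witt_factor_def log_deriv_power log_deriv_fps_geo power_mult_distrib power_mult fps_of_nat[symmetric] del: fps_of_nat)
next
  case False
  then have "\<not> lcm m n dvd Suc N" by (meson lcm_least dvd_lcm1 dvd_lcm2 dvd_trans)
  with False show ?thesis
    using assms by (auto simp: witt_factor_def log_deriv_power log_deriv_fps_geo lcm_pos_nat fps_of_nat[symmetric] simp del: fps_of_nat)
qed

text \<open>Ghost components turn the Witt product into a pointwise product: the double sum over all
  factors splits into a product of two sums.\<close>

lemma log_deriv_witt_prod:
  fixes F G :: "'a :: field fps"
  assumes "has_witt_comps F a" "has_witt_comps G b"
  shows "log_deriv (witt_prod a b) $ N = log_deriv F $ N * log_deriv G $ N"
proof -
  let ?I = "{1..Suc N}"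
  have "fps_agree N (log_deriv (witt_prod a b)) (log_deriv (\<Prod>m\<in>?I. \<Prod>n\<in>?I. witt_factor a b m n))"
    using witt_prod_agree[of "Suc N" a b] by (intro agree_log_deriv) (auto intro!: fps_prod_nth_0 simp del: prod.cl_ivl_Suc)
  then have "log_deriv (witt_prod a b) $ N = (\<Sum>m\<in>?I. \<Sum>n\<in>?I. log_deriv (witt_factor a b m n) $ N)"
    by (simp add: fps_agree_def log_deriv_prod fps_prod_nth_0 fps_sum_nth del: prod.cl_ivl_Suc sum.cl_ivl_Suc)
  also have "\<dots> = (\<Sum>m\<in>?I. \<Sum>n\<in>?I. (if m dvd Suc N then of_nat m * a m ^ (Suc N div m) else 0) *
      (if n dvd Suc N then of_nat n * b n ^ (Suc N div n) else 0))"
    by (intro sum.cong refl log_deriv_witt_factor) auto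
  also have "\<dots> = log_deriv F $ N * log_deriv G $ N"
    unfolding log_deriv_has_witt_comps[OF assms(1)] log_deriv_has_witt_comps[OF assms(2)] by (simp only: sum_product)
  finally show ?thesis .
qed

section \<open>Rationality in characteristic zero\<close>

definition fps_map :: "('a \<Rightarrow> 'b) \<Rightarrow> 'a fps \<Rightarrow> 'b fps"
  where "fps_map h F = Abs_fps (\<lambda>n. h (F $ n))"

lemma fps_map_nth [simp]: "fps_map h F $ n = h (F $ n)"
  by (simp add: fps_map_def)

locale comm_ring_hom_class =
  fixes h :: "'a :: comm_ring_1 \<Rightarrow> 'b :: comm_ring_1"
  assumes h_add: "h (x + y) = h x + h y"
    and h_mult: "h (x * y) = h x * h y"
    and h_1: "h 1 = 1"
begin

lemma h_0: "h 0 = 0"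
  using h_add[of 0 0] by simp

lemma h_sum: "h (sum f I) = (\<Sum>i\<in>I. h (f i))"
  by (induction I rule: infinite_finite_induct) (auto simp: h_0 h_add)

lemma h_power: "h (x ^ n) = h x ^ n"
  by (induction n) (auto simp: h_1 h_mult)

lemma fps_map_mult: "fps_map h (F * G) = fps_map h F * fps_map h G"
  by (rule fps_ext) (simp add: fps_mult_nth h_sum h_mult)

lemma fps_map_1: "fps_map h 1 = 1"
  by (rule fps_ext) (simp add: h_1 h_0)

lemma fps_map_power: "fps_map h (F ^ n) = fps_map h F ^ n"
  by (induction n) (auto simp: fps_map_1 fps_map_mult)

lemma fps_map_prod: "fps_map h (prod f I) = (\<Prod>i\<in>I. fps_map h (f i))"
  by (induction I rule: infinite_finite_induct) (auto simp: fps_map_1 fps_map_mult)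

lemma fps_map_fps_geo: "fps_map h (fps_geo m c) = fps_geo m (h c)"
  by (rule fps_ext) (simp add: fps_geo_nth h_power h_0)

lemma has_witt_comps_map:
  assumes "has_witt_comps F a"
  shows "has_witt_comps (fps_map h F) (\<lambda>n. h (a n))"
  unfolding has_witt_comps_def
proof (intro conjI allI)
  show "h (a 0) = 0" using assms by (simp add: has_witt_comps_def h_0)
  fix n
  have "fps_map h F $ n = fps_map h (\<Prod>m\<in>{1..n}. fps_geo m (a m)) $ n"
    using assms by (simp add: has_witt_comps_def)
  then show "fps_map h F $ n = (\<Prod>m\<in>{1..n}. fps_geo m (h (a m))) $ n"
    by (simp only: fps_map_prod fps_map_fps_geo)
qed

text \<open>Functoriality: each coefficient is a fixed polynomial expression in finitely many
  components.\<close>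

lemma witt_prod_map: "fps_map h (witt_prod a b) = witt_prod (\<lambda>n. h (a n)) (\<lambda>n. h (b n))"
proof (rule fps_ext)
  fix N
  have "fps_map h (witt_prod a b) $ N = fps_map h (\<Prod>m\<in>{1..N}. \<Prod>n\<in>{1..N}. witt_factor a b m n) $ N"
    by (simp add: witt_prod_def)
  then show "fps_map h (witt_prod a b) $ N = witt_prod (\<lambda>n. h (a n)) (\<lambda>n. h (b n)) $ N"
    by (simp only: witt_prod_def fps_map_prod fps_map_fps_geo fps_map_power witt_factor_def h_mult h_power Abs_fps_inverse fps_nth_Abs_fps)
qed

end

section \<open>Polynomials with constant term 1 and their power sums\<close>

text \<open>No root is 0 because \<open>p\<close> has constant term 1. Extracting \<open>- x\<close>
  from each factor \<open>t - x\<close> leaves \<open>1 - t/x\<close>, and the extracted scalars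
  multiply with the leading coefficient to 1. The multiset obtained consists of the reciprocals of
  the roots.\<close>

lemma alg_closed_factorization_reciprocal:
  fixes p :: "'a :: alg_closed_field poly"
  assumes "poly.coeff p 0 = 1"
  obtains A where "p = (\<Prod>x\<in>#A. [:1, - x:])"
proof -
  have "p \<noteq> 0" using assms by auto
  then obtain A c where p: "p = Polynomial.smult c (\<Prod>x\<in>#A. [:-x, 1:])"
    using alg_closed_imp_factorization by blast
  have c: "c * (\<Prod>x\<in>#A. - x) = 1"
    using assms unfolding p by (simp add: poly_0_coeff_0[symmetric] poly_prod_mset image_mset.compositionality o_def)
  then have "0 \<notin># A"
    by (metis (no_types, lifting) add.inverse_neutral image_mset_eq_image_mset_plusD in_image_mset mult_zero_right prod_mset_zero_iff rev_image_eqI zero_neq_one)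
  then have "(\<Prod>x\<in>#A. [:-x, 1:]) = Polynomial.smult (\<Prod>x\<in>#A. - x) (\<Prod>x\<in>#image_mset inverse A. [:1, - x:])"
  proof (induction A)
    case (add x A)
    then have "[:-x, 1:] = Polynomial.smult (- x) [:1, - inverse x:]" by auto
    then show ?case using add by (simp del: mult_pCons_left mult_pCons_right smult_pCons add: mult.commute)
  qed auto
  with c have "p = (\<Prod>x\<in>#image_mset inverse A. [:1, - x:])"
    unfolding p by simp
  then show ?thesis by (rule that)
qed

lemma log_deriv_prod_mset:
  assumes "\<And>x. x \<in># A \<Longrightarrow> poly.coeff (f x) 0 = (1 :: 'a :: field)"
  shows "log_deriv (fps_of_poly (\<Prod>x\<in>#A. f x)) = (\<Sum>x\<in>#A. log_deriv (fps_of_poly (f x)))"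
    and "poly.coeff (\<Prod>x\<in>#A. f x) 0 = 1"
proof -
  \<comment> \<open>Both claims go through one induction, since additivity needs the constant term
    of the remaining product.\<close>
  have "log_deriv (fps_of_poly (\<Prod>x\<in>#A. f x)) = (\<Sum>x\<in>#A. log_deriv (fps_of_poly (f x))) \<and>
     poly.coeff (\<Prod>x\<in>#A. f x) 0 = 1"
    using assms by (induction A) (auto simp: fps_of_poly_mult log_deriv_mult coeff_mult)
  then show "log_deriv (fps_of_poly (\<Prod>x\<in>#A. f x)) = (\<Sum>x\<in>#A. log_deriv (fps_of_poly (f x)))"
    and "poly.coeff (\<Prod>x\<in>#A. f x) 0 = 1" by auto
qed

lemma log_deriv_linear: "log_deriv (fps_of_poly [:1, - x:]) $ N = - (x ^ Suc N :: 'a :: field)"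
proof -
  have "fps_of_poly [:1, - x:] = 1 - fps_const x * fps_X ^ 1"
    by (simp add: fps_of_poly_pCons mult.commute)
  then have "fps_geo 1 x * fps_of_poly [:1, - x:] = 1"
    using fps_geo_inverse[of 1 x] by (simp only: zero_less_one)
  then have "log_deriv (fps_of_poly [:1, - x:]) = - log_deriv (fps_geo 1 x)"
    using log_deriv_inverse_unique[of "fps_geo 1 x"] by simp
  then show ?thesis by (simp add: log_deriv_fps_geo)
qed

lemma fps_sum_mset_nth: "(\<Sum>x\<in>#A. f x) $ n = (\<Sum>x\<in>#A. f x $ n)"
  by (induction A) auto

lemma sum_mset_uminus: "(\<Sum>x\<in>#A. - f x) = - (\<Sum>x\<in>#A. f x :: 'a :: ab_group_add)"
  by (induction A) auto

text \<open>The ghost components of a split polynomial are the negated power sums of its reciprocal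
  roots.\<close>

lemma log_deriv_split:
  "log_deriv (fps_of_poly (\<Prod>x\<in>#A. [:1, - x:])) $ N = - (\<Sum>x\<in>#A. (x ^ Suc N :: 'a :: field))"
  by (simp add: log_deriv_prod_mset fps_sum_mset_nth log_deriv_linear sum_mset_uminus)

lemma fps_right_inverse_1:
  fixes F :: "'a :: comm_ring_1 fps"
  assumes "F $ 0 = 1"
  obtains G where "F * G = 1" "G $ 0 = 1"
  using fps_right_inverse[of F 1] assms by simp

section \<open>Descent from an algebraically closed field of characteristic 0\<close>

locale comm_ring_embedding = comm_ring_hom_class h
  for h :: "'a :: comm_ring_1 \<Rightarrow> 'b :: {alg_closed_field, field_char_0}" +
  assumes h_inj: "inj h"
begin

lemma h_eq_0_iff: "h x = 0 \<longleftrightarrow> x = 0"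
  using h_inj h_0 by (metis injD)

lemma fps_map_eqD: "fps_map h F = fps_map h G \<Longrightarrow> F = G"
  using h_inj by (auto simp: fps_eq_iff dest: injD)

lemma log_deriv_witt_prod_map:
  assumes "has_witt_comps F a" "has_witt_comps G b"
  shows "log_deriv (fps_map h (witt_prod a b)) $ n = log_deriv (fps_map h F) $ n * log_deriv (fps_map h G) $ n"
  unfolding witt_prod_map by (intro log_deriv_witt_prod has_witt_comps_map assms)

text \<open>Over the field both polynomials split. The polynomial whose reciprocal roots are all
  products \<open>x * y\<close> has the negated ghost components of the Witt product, so it is the
  inverse of that product. The inverse also exists as a series over \<open>'a\<close>, and
  injectivity of \<open>h\<close> shows that it is a polynomial there.\<close>

lemma ex_poly_mult_witt_prod_eq_1:
  fixes p q :: "'a poly"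
  assumes "poly.coeff p 0 = 1" "poly.coeff q 0 = 1"
    and "has_witt_comps (fps_of_poly p) a" "has_witt_comps (fps_of_poly q) b"
  obtains r where "poly.coeff r 0 = 1" "fps_of_poly r * witt_prod a b = 1"
proof -
  obtain G where G: "witt_prod a b * G = 1" "G $ 0 = 1"
    using fps_right_inverse_1[of "witt_prod a b"] by auto
  have hp: "fps_map h (fps_of_poly s) = fps_of_poly (map_poly h s)" for s
    by (rule fps_ext) (simp add: coeff_map_poly h_0)
  obtain A where A: "map_poly h p = (\<Prod>x\<in>#A. [:1, - x:])"
    using alg_closed_factorization_reciprocal[of "map_poly h p"] assms h_1 h_0
    by (auto simp: coeff_map_poly)
  obtain B where B: "map_poly h q = (\<Prod>x\<in>#B. [:1, - x:])"
    using alg_closed_factorization_reciprocal[of "map_poly h q"] assms h_1 h_0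
    by (auto simp: coeff_map_poly)
  define r where "r = (\<Prod>x\<in>#A. \<Prod>y\<in>#B. [:1, - (x * y):])"
  have r0: "poly.coeff r 0 = 1"
    unfolding r_def by (intro log_deriv_prod_mset) auto
  have "log_deriv (fps_map h (witt_prod a b)) = - log_deriv (fps_map h G)"
    using G by (intro log_deriv_inverse_unique) (auto simp: h_1 fps_map_1 simp flip: fps_map_mult)
  moreover have "log_deriv (fps_of_poly r) $ N = - (log_deriv (fps_map h (witt_prod a b)) $ N)" for N
  proof -
    have "log_deriv (fps_of_poly r) = (\<Sum>x\<in>#A. log_deriv (fps_of_poly (\<Prod>y\<in>#B. [:1, - (x * y):])))"
      unfolding r_def by (rule log_deriv_prod_mset) (rule log_deriv_prod_mset, simp)
    also have "\<dots> = (\<Sum>x\<in>#A. \<Sum>y\<in>#B. log_deriv (fps_of_poly [:1, - (x * y):]))"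
      by (intro arg_cong[where f = sum_mset] image_mset_cong log_deriv_prod_mset) simp
    finally have "log_deriv (fps_of_poly r) $ N = (\<Sum>x\<in>#A. \<Sum>y\<in>#B. - ((x * y) ^ Suc N))"
      by (simp only: fps_sum_mset_nth log_deriv_linear)
    \<comment> \<open>The power sums of the products \<open>x * y\<close> are products of power
      sums.\<close>
    also have "(\<Sum>x\<in>#A. \<Sum>y\<in>#B. - ((x * y) ^ Suc N)) = - ((\<Sum>x\<in>#A. x ^ Suc N) * (\<Sum>y\<in>#B. y ^ Suc N))"
      by (simp add: sum_mset_uminus power_mult_distrib sum_mset_product del: power_Suc)
    \<comment> \<open>Each of the two logarithmic derivatives carries a minus sign; the two signs
      cancel.\<close>
    also have "\<dots> = - (log_deriv (fps_map h (fps_of_poly p)) $ N * log_deriv (fps_map h (fps_of_poly q)) $ N)"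
      by (simp add: hp A B log_deriv_split del: power_Suc)
    also have "\<dots> = - (log_deriv (fps_map h (witt_prod a b)) $ N)"
      by (simp only: log_deriv_witt_prod_map[OF assms(3,4)])
    finally show ?thesis .
  qed
  ultimately have "log_deriv (fps_map h G) = log_deriv (fps_of_poly r)"
    by (auto simp: fps_eq_iff)
  then have hG: "fps_map h G = fps_of_poly r"
    by (rule log_deriv_eqD) (use G r0 in \<open>auto simp: h_1\<close>)
  have "G $ n = 0" if "n > Polynomial.degree r" for n
    using arg_cong[OF hG, of "\<lambda>F. F $ n"] coeff_eq_0[OF that] by (simp add: h_eq_0_iff)
  \<comment> \<open>\<open>Abs_poly\<close> is meaningful here because the coefficients of
    \<open>G\<close> vanish beyond the degree of \<open>r\<close>.\<close>
  then have "poly.coeff (Abs_poly (fps_nth G)) n = G $ n" for n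
    by (metis coeff_Abs_poly)
  then have "fps_of_poly (Abs_poly (fps_nth G)) = G" "poly.coeff (Abs_poly (fps_nth G)) 0 = 1"
    using G by (simp_all add: fps_eq_iff)
  then show ?thesis
    using G by (intro that[of "Abs_poly (fps_nth G)"]) (simp_all add: mult.commute)
qed

text \<open>With \<open>F = p/q\<close> and \<open>G = p'/q'\<close>, the ghost components of the
  Witt product expand into four products. Each pair of polynomials contributes the inverse of a
  polynomial, so the pairs \<open>p, p'\<close> and \<open>q, q'\<close> give the denominator and
  the mixed pairs the numerator.\<close>

lemma witt_prod_rational:
  fixes p q p' q' :: "'a poly"
  assumes const: "poly.coeff p 0 = 1" "poly.coeff q 0 = 1" "poly.coeff p' 0 = 1" "poly.coeff q' 0 = 1"
    and F: "F * fps_of_poly q = fps_of_poly p" "has_witt_comps F a"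
    and G: "G * fps_of_poly q' = fps_of_poly p'" "has_witt_comps G b"
  obtains r s where "poly.coeff r 0 = 1" "poly.coeff s 0 = 1" "witt_prod a b * fps_of_poly s = fps_of_poly r"
proof -
  define N where "N = (\<lambda>x n. log_deriv (fps_map h (fps_of_poly x)) $ n)"
  \<comment> \<open>The witness is inverse to the Witt product of \<open>x\<close> and
    \<open>y\<close>, whence the sign.\<close>
  have ex: "\<exists>r. poly.coeff r 0 = 1 \<and> (\<forall>n. N r n = - (N x n * N y n))"
    if const: "poly.coeff x 0 = 1" "poly.coeff y 0 = 1" for x y :: "'a poly"
  proof -
    have c: "has_witt_comps (fps_of_poly x) (witt_comps (fps_of_poly x))" "has_witt_comps (fps_of_poly y) (witt_comps (fps_of_poly y))"
      using const by (auto intro!: has_witt_comps_witt_comps)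
    obtain r where r: "poly.coeff r 0 = 1"
      and w: "fps_of_poly r * witt_prod (witt_comps (fps_of_poly x)) (witt_comps (fps_of_poly y)) = 1"
      using const c by (rule ex_poly_mult_witt_prod_eq_1)
    have "log_deriv (fps_map h (fps_of_poly r)) = - log_deriv (fps_map h (witt_prod (witt_comps (fps_of_poly x)) (witt_comps (fps_of_poly y))))"
      using w r by (intro log_deriv_inverse_unique) (auto simp: h_1 fps_map_1 simp flip: fps_map_mult)
    then show ?thesis
      using r by (intro exI[of _ r]) (simp add: N_def log_deriv_witt_prod_map[OF c])
  qed
  obtain pp where pp: "poly.coeff pp 0 = 1" "\<And>n. N pp n = - (N p n * N p' n)" using ex const by metis
  obtain pq where pq: "poly.coeff pq 0 = 1" "\<And>n. N pq n = - (N p n * N q' n)" using ex const by metis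
  obtain qp where qp: "poly.coeff qp 0 = 1" "\<And>n. N qp n = - (N q n * N p' n)" using ex const by metis
  obtain qq where qq: "poly.coeff qq 0 = 1" "\<And>n. N qq n = - (N q n * N q' n)" using ex const by metis
  have NF: "log_deriv (fps_map h F) $ n = N p n - N q n" for n
    unfolding N_def F(1)[symmetric] fps_map_mult using F const
    by (subst log_deriv_mult) (auto simp: h_1 has_witt_comps_nth_0)
  have NG: "log_deriv (fps_map h G) $ n = N p' n - N q' n" for n
    unfolding N_def G(1)[symmetric] fps_map_mult using G const
    by (subst log_deriv_mult) (auto simp: h_1 has_witt_comps_nth_0)
  have m: "log_deriv (fps_map h (H * fps_of_poly x)) $ n = log_deriv (fps_map h H) $ n + N x n"
    if "H $ 0 = 1" "poly.coeff x 0 = 1" for H x n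
    using that by (simp add: fps_map_mult log_deriv_mult h_1 N_def)
  have "fps_map h (witt_prod a b * fps_of_poly (pp * qq)) = fps_map h (fps_of_poly (pq * qp))"
  proof (rule log_deriv_eqD)
    show "log_deriv (fps_map h (witt_prod a b * fps_of_poly (pp * qq))) = log_deriv (fps_map h (fps_of_poly (pq * qp)))"
    proof (rule fps_ext)
      fix n
      have "log_deriv (fps_map h (witt_prod a b)) $ n = (N p n - N q n) * (N p' n - N q' n)"
        by (simp only: log_deriv_witt_prod_map[OF F(2) G(2)] NF NG)
      then have "log_deriv (fps_map h (witt_prod a b * fps_of_poly (pp * qq))) $ n
          = (N p n - N q n) * (N p' n - N q' n) + N pp n + N qq n"
        using pp(1) qq(1) m[of "witt_prod a b * fps_of_poly pp" qq n] m[of "witt_prod a b" pp n]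
        by (simp add: fps_of_poly_mult mult.assoc)
      also have "\<dots> = N pq n + N qp n"
        unfolding pp(2) pq(2) qp(2) qq(2) by (simp add: algebra_simps)
      also have "\<dots> = log_deriv (fps_map h (fps_of_poly (pq * qp))) $ n"
        using pq(1) qp(1) m[of "fps_of_poly pq" qp n] by (simp add: fps_of_poly_mult N_def)
      finally show "log_deriv (fps_map h (witt_prod a b * fps_of_poly (pp * qq))) $ n
          = log_deriv (fps_map h (fps_of_poly (pq * qp))) $ n" .
    qed
  qed (use pp pq qp qq in \<open>auto simp: h_1 coeff_mult\<close>)
  then have "witt_prod a b * fps_of_poly (pp * qq) = fps_of_poly (pq * qp)"
    by (rule fps_map_eqD)
  then show ?thesis
    using pp pq qp qq by (intro that[of "pq * qp" "pp * qq"]) (auto simp: coeff_mult)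
qed

end

text \<open>Lets the algebraic closure of the fraction field inherit characteristic 0.\<close>

instance fract :: ("{idom,ring_char_0}") field_char_0
proof
  show "inj (of_nat :: nat \<Rightarrow> 'a fract)"
    by (rule injI) (simp add: of_nat_fract eq_fract)
qed

lemma to_ac_fract_embedding:
  "comm_ring_embedding (\<lambda>x :: 'a :: {idom, ring_char_0}. to_ac (to_fract x))"
  by unfold_locales (simp_all add: inj_def)

section \<open>Transfer to arbitrary commutative rings\<close>

definition cauchy :: "'r ring \<Rightarrow> (nat \<Rightarrow> 'r) \<Rightarrow> (nat \<Rightarrow> 'r) \<Rightarrow> nat \<Rightarrow> 'r"
  where "cauchy R f g n = (\<Oplus>\<^bsub>R\<^esub>i\<in>{..n}. f i \<otimes>\<^bsub>R\<^esub> g (n - i))"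

lemma power_series_simps:
  "carrier (power_series R) = UNIV \<rightarrow> carrier R"
  "f \<otimes>\<^bsub>power_series R\<^esub> g = cauchy R f g"
  "\<one>\<^bsub>power_series R\<^esub> = (\<lambda>n. if n = 0 then \<one>\<^bsub>R\<^esub> else \<zero>\<^bsub>R\<^esub>)"
  by (auto simp: power_series_def cauchy_def)

section \<open>The monoid of power series and uniqueness of Witt components\<close>

context
  fixes R :: "'r ring" (structure)
  assumes R: "cring R"
begin

interpretation cring R by (fact R)

lemma cauchy_closed:
  "f \<in> UNIV \<rightarrow> carrier R \<Longrightarrow> g \<in> UNIV \<rightarrow> carrier R \<Longrightarrow> cauchy R f g \<in> UNIV \<rightarrow> carrier R"
  by (auto simp: cauchy_def Pi_def intro!: finsum_closed)

lemma cauchy_cong: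
  assumes "f' \<in> UNIV \<rightarrow> carrier R" "g' \<in> UNIV \<rightarrow> carrier R"
    and "\<And>i. i \<le> n \<Longrightarrow> f i = f' i" "\<And>i. i \<le> n \<Longrightarrow> g i = g' i"
  shows "cauchy R f g n = cauchy R f' g' n"
  unfolding cauchy_def using assms by (intro finsum_cong') auto

definition truncate_series :: "nat \<Rightarrow> (nat \<Rightarrow> 'r) \<Rightarrow> nat \<Rightarrow> 'r"
  where "truncate_series n f = (\<lambda>i. if i \<le> n then f i else \<zero>\<^bsub>R\<^esub>)"

lemma truncate_series_in_up: "f \<in> UNIV \<rightarrow> carrier R \<Longrightarrow> truncate_series n f \<in> up R"
  by (auto simp: truncate_series_def intro!: mem_upI bound.intro exI[of _ n])

lemma truncate_series_closed: "f \<in> UNIV \<rightarrow> carrier R \<Longrightarrow> truncate_series n f \<in> UNIV \<rightarrow> carrier R"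
  by (auto simp: truncate_series_def)

lemma UP_mult_eq_cauchy: "p \<in> up R \<Longrightarrow> q \<in> up R \<Longrightarrow> p \<otimes>\<^bsub>UP R\<^esub> q = cauchy R p q"
  by (auto simp: UP_def cauchy_def)

text \<open>A coefficient of a product only depends on truncations of the factors, which are polynomials,
  so the laws are inherited from \<^const>\<open>UP\<close>.\<close>

lemma comm_monoid_power_series: "comm_monoid (power_series R)"
proof (rule comm_monoidI, unfold power_series_simps)
  interpret UP: cring "UP R"
    using UP_cring.UP_cring[of R] R by (simp add: UP_cring_def)
  have carrier: "p \<in> carrier (UP R) \<longleftrightarrow> p \<in> up R" for p by (simp add: UP_def)
  have up: "cauchy R p q \<in> up R" if "p \<in> up R" "q \<in> up R" for p q
    using UP.m_closed[of p q] that by (simp add: carrier UP_mult_eq_cauchy)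
  show "(\<lambda>n. if n = 0 then \<one> else \<zero>) \<in> UNIV \<rightarrow> carrier R" by auto
  fix f g :: "nat \<Rightarrow> 'r"
  assume f: "f \<in> UNIV \<rightarrow> carrier R" and g: "g \<in> UNIV \<rightarrow> carrier R"
  show "cauchy R f g \<in> UNIV \<rightarrow> carrier R" using f g by (rule cauchy_closed)
  show "cauchy R f g = cauchy R g f"
  proof
    fix n
    have "cauchy R f g n = cauchy R (truncate_series n f) (truncate_series n g) n"
      using f g by (intro cauchy_cong truncate_series_closed) (auto simp: truncate_series_def)
    also have "\<dots> = cauchy R (truncate_series n g) (truncate_series n f) n"
      using UP.m_comm[of "truncate_series n f" "truncate_series n g"] f g by (simp add: carrier UP_mult_eq_cauchy truncate_series_in_up)
    also have "\<dots> = cauchy R g f n"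
      using f g by (intro cauchy_cong) (auto simp: truncate_series_def)
    finally show "cauchy R f g n = cauchy R g f n" .
  qed
  show "cauchy R (\<lambda>n. if n = 0 then \<one> else \<zero>) f = f"
  proof
    fix n
    have "cauchy R (\<lambda>n. if n = 0 then \<one> else \<zero>) f n = (\<Oplus>i\<in>{..n}. if 0 = i then f n else \<zero>)"
      unfolding cauchy_def using f by (intro finsum_cong') (auto simp: Pi_def)
    also have "\<dots> = f n"
      using f by (intro finsum_singleton) auto
    finally show "cauchy R (\<lambda>n. if n = 0 then \<one> else \<zero>) f n = f n" .
  qed
  fix h :: "nat \<Rightarrow> 'r"
  assume h: "h \<in> UNIV \<rightarrow> carrier R"
  show "cauchy R (cauchy R f g) h = cauchy R f (cauchy R g h)"
  proof
    fix n
    have t: "cauchy R u v i = cauchy R (truncate_series n u) (truncate_series n v) i"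
      if "i \<le> n" "u \<in> UNIV \<rightarrow> carrier R" "v \<in> UNIV \<rightarrow> carrier R" for u v i
      using that by (intro cauchy_cong truncate_series_closed) (auto simp: truncate_series_def)
    have "cauchy R (cauchy R f g) h n = cauchy R (cauchy R (truncate_series n f) (truncate_series n g)) (truncate_series n h) n"
      using f g h t by (intro cauchy_cong cauchy_closed truncate_series_closed) (auto simp: truncate_series_def)
    also have "\<dots> = cauchy R (truncate_series n f) (cauchy R (truncate_series n g) (truncate_series n h)) n"
      using UP.m_assoc[of "truncate_series n f" "truncate_series n g" "truncate_series n h"] f g h
      by (simp add: carrier UP_mult_eq_cauchy truncate_series_in_up up)
    also have "\<dots> = cauchy R f (cauchy R g h) n"
      using f g h t[symmetric] by (intro cauchy_cong cauchy_closed) (auto simp: truncate_series_def)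
    finally show "cauchy R (cauchy R f g) h n = cauchy R f (cauchy R g h) n" .
  qed
qed

interpretation PS: comm_monoid "power_series R" by (fact comm_monoid_power_series)

lemma geo_closed: "c \<in> carrier R \<Longrightarrow> geo R m c \<in> UNIV \<rightarrow> carrier R"
  by (auto simp: geo_def)

lemma finprod_power_series_nth_0:
  assumes "finite I" "\<And>i. i \<in> I \<Longrightarrow> f i \<in> UNIV \<rightarrow> carrier R" "\<And>i. i \<in> I \<Longrightarrow> f i 0 = \<one>"
  shows "(\<Otimes>\<^bsub>power_series R\<^esub>i\<in>I. f i) 0 = \<one>"
  using assms
proof (induction I rule: finite_induct)
  case (insert i I)
  then have "(\<Otimes>\<^bsub>power_series R\<^esub>i\<in>I. f i) \<in> carrier (power_series R)"
    by (intro PS.finprod_closed) (auto simp: power_series_simps)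
  moreover have "(\<Otimes>\<^bsub>power_series R\<^esub>i\<in>insert i I. f i) = f i \<otimes>\<^bsub>power_series R\<^esub> (\<Otimes>\<^bsub>power_series R\<^esub>i\<in>I. f i)"
    using insert by (intro PS.finprod_insert) (auto simp: power_series_simps)
  ultimately show ?case using insert
    by (simp add: power_series_simps cauchy_def)
qed (auto simp: power_series_simps)

lemma finprod_geo_step:
  assumes "n > 0" and a: "a \<in> UNIV \<rightarrow> carrier R"
  shows "(\<Otimes>\<^bsub>power_series R\<^esub>m\<in>{1..n}. geo R m (a m)) n =
    a n \<oplus> (\<Otimes>\<^bsub>power_series R\<^esub>m\<in>{1..<n}. geo R m (a m)) n"
proof -
  let ?G = "\<Otimes>\<^bsub>power_series R\<^esub>m\<in>{1..<n}. geo R m (a m)"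
  have geo: "geo R m (a m) \<in> carrier (power_series R)" for m
    using a geo_closed by (auto simp: power_series_simps)
  have G: "?G \<in> UNIV \<rightarrow> carrier R"
    using PS.finprod_closed[of "\<lambda>m. geo R m (a m)" "{1..<n}"] geo by (auto simp: power_series_simps)
  have Gn: "?G i \<in> carrier R" for i using G by auto
  have gn: "geo R n (a n) i \<in> carrier R" for i using geo[of n] by (auto simp: power_series_simps)
  have G0: "?G 0 = \<one>"
    using a geo by (intro finprod_power_series_nth_0) (auto simp: power_series_simps geo_def)
  have "{1..n} = insert n {1..<n}" using assms by auto
  then have "(\<Otimes>\<^bsub>power_series R\<^esub>m\<in>{1..n}. geo R m (a m)) = cauchy R ?G (geo R n (a n))"
    using geo PS.m_comm[OF geo[of n], of ?G] G
    by (simp add: power_series_simps)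
  then have "(\<Otimes>\<^bsub>power_series R\<^esub>m\<in>{1..n}. geo R m (a m)) n = cauchy R ?G (geo R n (a n)) n"
    by simp
  also have "\<dots> =
      (\<Oplus>i\<in>insert 0 (insert n {1..<n}). ?G i \<otimes> geo R n (a n) (n - i))"
    unfolding cauchy_def using assms by (intro arg_cong2[where f = "finsum R"] refl) auto
  also have "\<dots> = ?G 0 \<otimes> geo R n (a n) n \<oplus> (?G n \<otimes> geo R n (a n) 0 \<oplus> (\<Oplus>i\<in>{1..<n}. ?G i \<otimes> geo R n (a n) (n - i)))"
    using assms by (simp add: Gn gn Pi_def del: One_nat_def)
  also have "(\<Oplus>i\<in>{1..<n}. ?G i \<otimes> geo R n (a n) (n - i)) = (\<Oplus>i\<in>{1..<n}. \<zero>)"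
    using Gn by (intro finsum_cong') (auto simp: geo_def dest: dvd_imp_le)
  finally show ?thesis
  proof -
    assume eq: "(\<Otimes>\<^bsub>power_series R\<^esub>m\<in>{1..n}. geo R m (a m)) n =
      ?G 0 \<otimes> geo R n (a n) n \<oplus> (?G n \<otimes> geo R n (a n) 0 \<oplus> (\<Oplus>i\<in>{1..<n}. \<zero>))"
    have "a n \<in> carrier R" using a by auto
    moreover from this have "geo R n (a n) n = a n" "geo R n (a n) 0 = \<one>"
      using assms by (simp_all add: geo_def)
    ultimately show ?thesis
      unfolding eq by (simp add: G0 Gn del: One_nat_def)
  qed
qed

text \<open>By strong induction, coefficient \<open>n\<close> determines component \<open>n\<close>
  once the earlier ones are known. Uniqueness is what evaluates the definite description in
  \<open>witt_components\<close>.\<close>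

lemma witt_components_eqI:
  assumes a: "a \<in> UNIV \<rightarrow> carrier R" "a 0 = \<zero>"
    and f: "\<And>n. f n = (\<Otimes>\<^bsub>power_series R\<^esub>m\<in>{1..n}. geo R m (a m)) n"
  shows "witt_components R f = a"
  unfolding witt_components_def
proof (rule the_equality)
  show "a \<in> UNIV \<rightarrow> carrier R \<and> a 0 = \<zero> \<and>
      (\<forall>n. f n = (\<Otimes>\<^bsub>power_series R\<^esub>m\<in>{1..n}. geo R m (a m)) n)"
    using assms by auto
  fix b assume b: "b \<in> UNIV \<rightarrow> carrier R \<and> b 0 = \<zero> \<and>
      (\<forall>n. f n = (\<Otimes>\<^bsub>power_series R\<^esub>m\<in>{1..n}. geo R m (b m)) n)"
  have "b n = a n" for n
  proof (induction n rule: less_induct)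
    case (less n)
    show ?case
    proof (cases "n = 0")
      case False
      let ?G = "\<Otimes>\<^bsub>power_series R\<^esub>m\<in>{1..<n}. geo R m (a m)"
      have geo: "geo R m (a m) \<in> carrier (power_series R)" for m
        using a geo_closed by (auto simp: power_series_simps)
      have "(\<Otimes>\<^bsub>power_series R\<^esub>m\<in>{1..<n}. geo R m (b m)) = ?G"
        using less geo by (intro PS.finprod_cong') auto
      then have "b n \<oplus> ?G n = f n"
        using False b finprod_geo_step[of n b] by (simp del: One_nat_def)
      moreover have "a n \<oplus> ?G n = f n"
        unfolding f using False a finprod_geo_step[of n a] by (simp del: One_nat_def)
      moreover have "?G n \<in> carrier R"
        using PS.finprod_closed[of "\<lambda>m. geo R m (a m)" "{1..<n}"] geo by (auto simp: power_series_simps)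
      moreover have "a n \<in> carrier R" "b n \<in> carrier R"
        using a b by auto
      ultimately show ?thesis
        using add.right_cancel[of "?G n" "b n" "a n"] by simp
    qed (use a b in auto)
  qed
  then show "b = a" by auto
qed

end

section \<open>Homomorphisms from a type-class ring to a ring with carrier\<close>

locale class_to_cring = cring R for R :: "'r ring" (structure) +
  fixes \<phi> :: "'a :: comm_ring_1 \<Rightarrow> 'r"
  assumes phi_closed [simp]: "\<phi> x \<in> carrier R"
    and phi_add: "\<phi> (x + y) = \<phi> x \<oplus> \<phi> y"
    and phi_mult: "\<phi> (x * y) = \<phi> x \<otimes> \<phi> y"
    and phi_1: "\<phi> 1 = \<one>"
begin

sublocale PS: comm_monoid "power_series R"
  by (rule comm_monoid_power_series) (rule is_cring)

lemma phi_0: "\<phi> 0 = \<zero>"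
  using phi_add[of 0 0] by (metis add.r_cancel_one' add_0 phi_closed)

lemma phi_sum: "finite I \<Longrightarrow> \<phi> (sum f I) = (\<Oplus>i\<in>I. \<phi> (f i))"
  by (induction I rule: finite_induct) (auto simp: phi_0 phi_add)

lemma phi_power: "\<phi> (x ^ n) = \<phi> x [^] n"
  by (induction n) (auto simp: phi_1 phi_mult m_comm)

definition \<Phi> :: "'a fps \<Rightarrow> nat \<Rightarrow> 'r"
  where "\<Phi> F = (\<lambda>n. \<phi> (F $ n))"

lemma Phi_closed: "\<Phi> F \<in> carrier (power_series R)"
  by (simp add: \<Phi>_def power_series_simps)

lemma Phi_1: "\<Phi> 1 = \<one>\<^bsub>power_series R\<^esub>"
  by (auto simp: \<Phi>_def power_series_simps phi_1 phi_0)

lemma Phi_mult: "\<Phi> (F * G) = \<Phi> F \<otimes>\<^bsub>power_series R\<^esub> \<Phi> G"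
  by (auto simp: \<Phi>_def power_series_simps cauchy_def fps_mult_nth phi_sum phi_mult atLeast0AtMost)

lemma Phi_power: "\<Phi> (F ^ n) = \<Phi> F [^]\<^bsub>power_series R\<^esub> n"
  by (induction n) (simp_all add: Phi_1 Phi_mult PS.m_comm Phi_closed)

lemma Phi_prod: "finite I \<Longrightarrow> \<Phi> (prod f I) = (\<Otimes>\<^bsub>power_series R\<^esub>i\<in>I. \<Phi> (f i))"
  by (induction I rule: finite_induct) (simp_all add: Phi_1 Phi_mult Phi_closed)

lemma Phi_fps_geo: "\<Phi> (fps_geo m c) = geo R m (\<phi> c)"
  by (auto simp: \<Phi>_def geo_def fps_geo_nth phi_power phi_0)

lemma witt_components_Phi:
  assumes "has_witt_comps F a"
  shows "witt_components R (\<Phi> F) = (\<lambda>m. \<phi> (a m))"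
proof (rule witt_components_eqI)
  show "\<phi> (a 0) = \<zero>" using assms by (simp add: has_witt_comps_def phi_0)
  fix n
  have "\<Phi> F n = \<Phi> (\<Prod>m\<in>{1..n}. fps_geo m (a m)) n"
    using assms by (simp add: has_witt_comps_def \<Phi>_def)
  then show "\<Phi> F n = (\<Otimes>\<^bsub>power_series R\<^esub>m\<in>{1..n}. geo R m (\<phi> (a m))) n"
    by (simp add: Phi_prod Phi_fps_geo del: One_nat_def)
qed (auto simp: is_cring)

text \<open>Coefficient \<open>N\<close> of both sides is the same finite product of geometric
  series, which \<open>\<Phi>\<close> respects.\<close>

lemma witt_mult_Phi:
  assumes "has_witt_comps F a" "has_witt_comps G b"
  shows "witt_mult R (\<Phi> F) (\<Phi> G) = \<Phi> (witt_prod a b)"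
proof
  fix N
  have "\<Phi> (witt_prod a b) N = \<Phi> (\<Prod>m\<in>{1..N}. \<Prod>n\<in>{1..N}. witt_factor a b m n) N"
    by (simp add: \<Phi>_def witt_prod_def)
  also have "\<dots> = witt_mult R (\<Phi> F) (\<Phi> G) N"
    unfolding witt_mult_def
    by (simp add: witt_components_Phi[OF assms(1)] witt_components_Phi[OF assms(2)] witt_factor_def
        Phi_prod Phi_power Phi_fps_geo phi_mult phi_power del: One_nat_def)
  finally show "witt_mult R (\<Phi> F) (\<Phi> G) N = \<Phi> (witt_prod a b) N" by simp
qed

lemma comm_monoid_add_big_witt: "comm_monoid (add_monoid (big_witt R))"
proof (rule comm_monoidI)
  fix x y z
  assume "x \<in> carrier (add_monoid (big_witt R))" "y \<in> carrier (add_monoid (big_witt R))"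
  then have c: "x \<in> carrier (power_series R)" "y \<in> carrier (power_series R)" "x 0 = \<one>" "y 0 = \<one>"
    by (auto simp: big_witt_def power_series_simps)
  have "(x \<otimes>\<^bsub>power_series R\<^esub> y) 0 = \<one>"
    using c by (simp add: power_series_simps cauchy_def)
  then show "x \<otimes>\<^bsub>add_monoid (big_witt R)\<^esub> y \<in> carrier (add_monoid (big_witt R))"
    using PS.m_closed[OF c(1,2)] by (auto simp: big_witt_def power_series_simps(1))
  show "x \<otimes>\<^bsub>add_monoid (big_witt R)\<^esub> y = y \<otimes>\<^bsub>add_monoid (big_witt R)\<^esub> x"
    using PS.m_comm[OF c(1,2)] by (simp add: big_witt_def)
  show "\<one>\<^bsub>add_monoid (big_witt R)\<^esub> \<otimes>\<^bsub>add_monoid (big_witt R)\<^esub> x = x"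
    using PS.l_one[OF c(1)] by (simp add: big_witt_def)
  assume "z \<in> carrier (add_monoid (big_witt R))"
  then have "z \<in> carrier (power_series R)" by (auto simp: big_witt_def power_series_simps)
  then show "x \<otimes>\<^bsub>add_monoid (big_witt R)\<^esub> y \<otimes>\<^bsub>add_monoid (big_witt R)\<^esub> z =
      x \<otimes>\<^bsub>add_monoid (big_witt R)\<^esub> (y \<otimes>\<^bsub>add_monoid (big_witt R)\<^esub> z)"
    using PS.m_assoc[OF c(1,2)] by (simp add: big_witt_def)
qed (auto simp: big_witt_def power_series_simps)

text \<open>Addition in the Witt ring is multiplication of series, so its subtraction is division:
  the negative of \<open>\<Phi> G\<close> is the image of the reciprocal of
  \<open>G\<close>.\<close>

lemma Phi_minus:
  assumes "F * G = H" "F $ 0 = 1" "G $ 0 = 1"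
  shows "\<Phi> H \<ominus>\<^bsub>big_witt R\<^esub> \<Phi> G = \<Phi> F"
proof -
  interpret W: comm_monoid "add_monoid (big_witt R)" by (rule comm_monoid_add_big_witt)
  obtain G' where G': "G * G' = 1" "G' $ 0 = 1"
    using fps_right_inverse_1 assms by blast
  have "\<ominus>\<^bsub>big_witt R\<^esub> \<Phi> G = \<Phi> G'"
    unfolding a_inv_def
  proof (rule W.comm_inv_char)
    show "\<Phi> G \<in> carrier (add_monoid (big_witt R))" "\<Phi> G' \<in> carrier (add_monoid (big_witt R))"
      using assms G' by (auto simp: big_witt_def \<Phi>_def phi_1)
    show "\<Phi> G \<otimes>\<^bsub>add_monoid (big_witt R)\<^esub> \<Phi> G' = \<one>\<^bsub>add_monoid (big_witt R)\<^esub>"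
      using Phi_mult[of G G'] G' by (simp add: big_witt_def Phi_1)
  qed
  then have "\<Phi> H \<ominus>\<^bsub>big_witt R\<^esub> \<Phi> G = \<Phi> (F * (G * G'))"
    unfolding assms(1)[symmetric] mult.assoc[symmetric] by (simp add: a_minus_def Phi_mult) (simp add: big_witt_def)
  then show ?thesis using G' by simp
qed

lemma Phi_fps_of_poly_in_up: "\<Phi> (fps_of_poly p) \<in> up R"
  by (auto simp: \<Phi>_def coeff_eq_0 phi_0 intro!: mem_upI bound.intro exI[of _ "Polynomial.degree p"])

end

section \<open>Lifting to integer polynomials in infinitely many variables\<close>

text \<open>The domain of \<open>\<phi>\<close> is the integer polynomial ring: monomials are
  finitely supported exponent functions. Additively it is free on the monomials, so evaluation of
  monomials extends to a group homomorphism; biadditivity reduces its multiplicativity to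
  monomials.\<close>

lemma ex_hom_from_polynomials:
  fixes R :: "'r ring" (structure) and x :: "nat \<Rightarrow> 'r"
  assumes R: "cring R" and x: "\<And>i. x i \<in> carrier R"
  obtains \<phi> :: "((nat \<Rightarrow>\<^sub>0 nat) \<Rightarrow>\<^sub>0 int) \<Rightarrow> 'r" and v
  where "class_to_cring R \<phi>" "\<And>i. \<phi> (v i) = x i"
proof -
  interpret cring R by (fact R)
  define mon where "mon m = (\<Otimes>i\<in>Poly_Mapping.keys m. x i [^] poly_mapping.lookup m i)" for m :: "nat \<Rightarrow>\<^sub>0 nat"
  have mon_closed: "mon m \<in> carrier R" for m
    unfolding mon_def using x by (intro finprod_closed) auto
  have mon_superset: "mon m = (\<Otimes>i\<in>S. x i [^] poly_mapping.lookup m i)"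
    if "finite S" "Poly_Mapping.keys m \<subseteq> S" for m S
    unfolding mon_def using that x
    by (intro add.finprod_mono_neutral_cong_left finprod_mono_neutral_cong_left) (auto simp: in_keys_iff)
  have mon_add: "mon (m + m') = mon m \<otimes> mon m'" for m m'
  proof -
    \<comment> \<open>A common index set for the three monomials, whose sets of occurring variables
      differ.\<close>
    let ?S = "Poly_Mapping.keys m \<union> Poly_Mapping.keys m'"
    have "mon (m + m') = (\<Otimes>i\<in>?S. x i [^] poly_mapping.lookup m i \<otimes> x i [^] poly_mapping.lookup m' i)"
      using keys_add[of m m'] x
      by (subst mon_superset[of ?S]) (auto simp: lookup_add nat_pow_mult)
    also have "\<dots> = mon m \<otimes> mon m'"
      using x by (subst (1 2) mon_superset[of ?S]) (auto intro!: finprod_multf)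
    finally show ?thesis .
  qed
  obtain \<phi> where "\<phi> \<in> hom (free_Abelian_group UNIV) (add_monoid R)" and frag: "\<And>m. \<phi> (frag_of m) = mon m"
    using comm_group.free_Abelian_group_universal[OF a_comm_group, of mon UNIV] mon_closed by auto
  then have closed: "\<phi> c \<in> carrier R" and add: "\<phi> (c + d) = \<phi> c \<oplus> \<phi> d" for c d
    by (auto simp: hom_def)
  have diff: "\<phi> (c - d) = \<phi> c \<ominus> \<phi> d" for c d
    using add[of "c - d" d] closed[of c] closed[of d] closed[of "c - d"]
    by (simp add: a_minus_def a_assoc r_neg)
  have zero: "\<phi> 0 = \<zero>"
    using diff[of 0 0] closed[of 0] by (simp add: a_minus_def r_neg)
  have mult1: "\<phi> (frag_of m * d) = \<phi> (frag_of m) \<otimes> \<phi> d" for m d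
    using subset_UNIV[of "Poly_Mapping.keys d"]
  proof (induction d rule: frag_induction)
    case (one m')
    then show ?case by (simp add: mult_single frag mon_add)
  next
    case (diff a b)
    then show ?case
      by (simp add: right_diff_distrib \<open>\<And>c d. \<phi> (c - d) = \<phi> c \<ominus> \<phi> d\<close> closed a_minus_def r_distr r_minus)
  qed (use zero closed in auto)
  have mult: "\<phi> (c * d) = \<phi> c \<otimes> \<phi> d" for c d
    using subset_UNIV[of "Poly_Mapping.keys c"]
  proof (induction c rule: frag_induction)
    case (one m)
    then show ?case by (simp add: mult1)
  next
    case (diff a b)
    then show ?case
      by (simp add: left_diff_distrib \<open>\<And>c d. \<phi> (c - d) = \<phi> c \<ominus> \<phi> d\<close> closed a_minus_def l_distr l_minus)
  qed (use zero closed in auto)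
  have "\<phi> 1 = \<one>"
    using frag[of 0] by (simp add: mon_def)
  then have "class_to_cring R \<phi>"
    using closed add mult by unfold_locales
  \<comment> \<open>The variable of index \<open>i\<close> is the monomial with exponent 1 at
    \<open>i\<close>.\<close>
  moreover have "\<phi> (frag_of (Poly_Mapping.single i 1)) = x i" for i
    using x[of i] by (simp add: frag mon_def)
  ultimately show ?thesis by (rule that)
qed

context class_to_cring
begin

lemma lift_polynomial:
  assumes p: "p \<in> up R" "p 0 = \<one>" and v: "\<And>i. \<phi> (v i) = p i"
  obtains P where "poly.coeff P 0 = 1" "\<Phi> (fps_of_poly P) = p"
proof -
  obtain n where n: "bound \<zero> n p" using p by auto
  \<comment> \<open>The bound \<open>n\<close> and the constant term 1 are imposed by hand:
    \<open>v i\<close> may be nonzero where \<open>p i\<close> is zero, and \<open>v 0\<close> need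
    not be 1.\<close>
  define P where "P = Abs_poly (\<lambda>i. if i \<le> n then if i = 0 then 1 else v i else 0)"
  have P: "poly.coeff P i = (if i \<le> n then if i = 0 then 1 else v i else 0)" for i
    unfolding P_def by (subst coeff_Abs_poly_If_le) simp
  have "\<Phi> (fps_of_poly P) i = p i" for i
    using bound.bound[OF n, of i] p v by (auto simp: \<Phi>_def P phi_1 phi_0)
  then show ?thesis using P[of 0] by (intro that[of P]) auto
qed

end

text \<open>All four polynomials lift to the integer polynomial ring, and with them the two
  quotients. There the Witt product is a quotient of polynomials, and \<open>\<Phi>\<close> carries
  this back to \<open>R\<close>.\<close>

lemma witt_rational_witt_mult:
  fixes R :: "'r ring" (structure)
  assumes R: "cring R" and f: "f \<in> witt_rational R" and g: "g \<in> witt_rational R"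
  shows "witt_mult R f g \<in> witt_rational R"
proof -
  interpret cring R by (fact R)
  obtain p q where p: "p \<in> up R" "p 0 = \<one>" and q: "q \<in> up R" "q 0 = \<one>" and f_eq: "f = p \<ominus>\<^bsub>big_witt R\<^esub> q"
    using f by (auto simp: witt_rational_def)
  obtain p' q' where p': "p' \<in> up R" "p' 0 = \<one>" and q': "q' \<in> up R" "q' 0 = \<one>" and g_eq: "g = p' \<ominus>\<^bsub>big_witt R\<^esub> q'"
    using g by (auto simp: witt_rational_def)
  \<comment> \<open>interleaves the coefficients of the four polynomials, so that one homomorphism lifts all of them\<close>
  define x where "x i = ([p, q, p', q'] ! (i mod 4)) (i div 4)" for i
  have "[p, q, p', q'] ! (i mod 4) \<in> up R" for i
  proof -
    have "[p, q, p', q'] ! (i mod 4) \<in> set [p, q, p', q']" by (intro nth_mem) simp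
    then show ?thesis using p q p' q' by auto
  qed
  then have x: "x i \<in> carrier R" for i
    unfolding x_def by (rule mem_upD)
  obtain \<phi> :: "((nat \<Rightarrow>\<^sub>0 nat) \<Rightarrow>\<^sub>0 int) \<Rightarrow> 'r" and v where \<phi>: "class_to_cring R \<phi>" and v: "\<And>i. \<phi> (v i) = x i"
    by (rule ex_hom_from_polynomials[OF R, of x]) (use x in auto)
  interpret class_to_cring R \<phi> by (fact \<phi>)
  have x4: "x (4 * i + c) = ([p, q, p', q'] ! c) i" if "c < 4" for i c
    using that by (simp add: x_def)
  have v4: "\<phi> (v (4 * i + 0)) = p i" "\<phi> (v (4 * i + 1)) = q i"
    "\<phi> (v (4 * i + 2)) = p' i" "\<phi> (v (4 * i + 3)) = q' i" for i
    unfolding v by (subst x4; simp)+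
  obtain P where P: "poly.coeff P 0 = 1" "\<Phi> (fps_of_poly P) = p" using lift_polynomial[OF p v4(1)] by blast
  obtain Q where Q: "poly.coeff Q 0 = 1" "\<Phi> (fps_of_poly Q) = q" using lift_polynomial[OF q v4(2)] by blast
  obtain P' where P': "poly.coeff P' 0 = 1" "\<Phi> (fps_of_poly P') = p'" using lift_polynomial[OF p' v4(3)] by blast
  obtain Q' where Q': "poly.coeff Q' 0 = 1" "\<Phi> (fps_of_poly Q') = q'" using lift_polynomial[OF q' v4(4)] by blast
  have quot: "\<exists>F. F $ 0 = 1 \<and> F * fps_of_poly V = fps_of_poly U"
    if UV: "poly.coeff U 0 = 1" "poly.coeff V 0 = 1" for U V :: "((nat \<Rightarrow>\<^sub>0 nat) \<Rightarrow>\<^sub>0 int) poly"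
  proof -
    obtain V' where "fps_of_poly V * V' = 1" "V' $ 0 = 1"
      by (rule fps_right_inverse_1[of "fps_of_poly V"]) (use UV in auto)
    then show ?thesis using UV
      by (intro exI[of _ "fps_of_poly U * V'"]) (simp add: mult.assoc mult.commute[of V'])
  qed
  obtain F where F: "F $ 0 = 1" "F * fps_of_poly Q = fps_of_poly P" using quot P Q by blast
  obtain G where G: "G $ 0 = 1" "G * fps_of_poly Q' = fps_of_poly P'" using quot P' Q' by blast
  have fF: "f = \<Phi> F" unfolding f_eq P(2)[symmetric] Q(2)[symmetric] using F Q by (intro Phi_minus) auto
  have gG: "g = \<Phi> G" unfolding g_eq P'(2)[symmetric] Q'(2)[symmetric] using G Q' by (intro Phi_minus) auto
  note witt_comps = has_witt_comps_witt_comps[OF F(1)] has_witt_comps_witt_comps[OF G(1)]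
  \<comment> \<open>The embedding into the algebraic closure is used only here; \<open>r\<close> and
    \<open>s\<close> already have coefficients in the polynomial ring.\<close>
  obtain r s where rs: "poly.coeff r 0 = 1" "poly.coeff s 0 = 1"
    "witt_prod (witt_comps F) (witt_comps G) * fps_of_poly s = fps_of_poly r"
    using comm_ring_embedding.witt_prod_rational[OF to_ac_fract_embedding P(1) Q(1) P'(1) Q'(1) F(2) witt_comps(1) G(2) witt_comps(2)]
    by blast
  have "witt_mult R f g = \<Phi> (witt_prod (witt_comps F) (witt_comps G))"
    unfolding fF gG by (rule witt_mult_Phi[OF witt_comps])
  also have "\<dots> = \<Phi> (fps_of_poly r) \<ominus>\<^bsub>big_witt R\<^esub> \<Phi> (fps_of_poly s)"
    using rs by (intro Phi_minus[symmetric]) auto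
  finally have "witt_mult R f g = \<Phi> (fps_of_poly r) \<ominus>\<^bsub>big_witt R\<^esub> \<Phi> (fps_of_poly s)" .
  moreover have "\<Phi> (fps_of_poly r) 0 = \<one>" "\<Phi> (fps_of_poly s) 0 = \<one>"
    using rs(1,2) by (simp_all add: \<Phi>_def phi_1)
  ultimately show ?thesis
    unfolding witt_rational_def using Phi_fps_of_poly_in_up[of r] Phi_fps_of_poly_in_up[of s] by blast
qed

section \<open>Application to zeta functions\<close>

lemma K0_class_in_carrier:
  assumes "is_K0Var k K" "variety k V"
  shows "K0_class k V \<in> carrier K"
proof -
  have "frag_of (iso_class k V) \<in> carrier (class_group k)"
    using assms by (auto simp: class_group_def)
  then show ?thesis
    using assms by (auto simp: is_K0Var_def K0_group_def K0_class_def carrier_FactGroup)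
qed

theorem proposition4p3:
  fixes k :: "'a ring" and R :: "'r ring"
    and K :: "('a sch set \<Rightarrow>\<^sub>0 int) set ring"
    and \<mu> :: "('a sch set \<Rightarrow>\<^sub>0 int) set \<Rightarrow> 'r"
    and V W P :: "'a sch"
  assumes "field k" and "cring R"
    and "is_K0Var k K"
    and "motivic_measure K R \<mu>"
    and "can_be_exponentiated k K R \<mu>"
    and "variety k V" and "variety k W"
    and "is_product k V W P"
    and "kapranov_zeta k K R \<mu> (K0_class k V) \<in> witt_rational R"
    and "kapranov_zeta k K R \<mu> (K0_class k W) \<in> witt_rational R"
  shows "kapranov_zeta k K R \<mu> (K0_class k P) \<in> witt_rational R"
proof -
  have "K0_class k P = K0_class k V \<otimes>\<^bsub>K\<^esub> K0_class k W"
    using assms by (auto simp: is_K0Var_def)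
  moreover have "kapranov_zeta k K R \<mu> \<in> ring_hom K (big_witt R)"
    using assms by (simp add: can_be_exponentiated_def)
  \<comment> \<open>Exponentiability makes the zeta function multiplicative, and the multiplication
    of \<open>big_witt R\<close> is \<open>witt_mult R\<close>.\<close>
  ultimately have "kapranov_zeta k K R \<mu> (K0_class k P) =
      witt_mult R (kapranov_zeta k K R \<mu> (K0_class k V)) (kapranov_zeta k K R \<mu> (K0_class k W))"
    using assms by (simp add: ring_hom_mult K0_class_in_carrier) (simp add: big_witt_def)
  then show ?thesis
    using witt_rational_witt_mult[OF \<open>cring R\<close> assms(9,10)] by simp
qed

end
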